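(* Let $H$ be a strongly verbally closed group that is finitely generated modulo its centre (i.e. $H/Z(H)$ is finitely generated). Let $p$ be a prime, $k$ a positive integer and $b\in H$ an element such that $b^{p^k}\in Z(H)$ but $b^{p^k}$ is not the $p^k$th power of any element of $Z(H)$. Then, for every positive integer $n$, the group $H$ decomposes into a product $H=K_1K_2\cdots K_n$ of $n$ pairwise commuting subgroups (i.e. every element of $K_i$ commutes with every element of $K_j$ for $i\ne j$) none of which is contained in the centraliser in $H$ of the set $$\left\{h\in H \mid h^{p^k}=1,\ [h,b]=1\right\}.$$ (In particular, this set is not contained in the centre of $H$.)
   Context: $Z(H)$ denotes the centre of $H$ and $[x,y]=x^{-1}y^{-1}xy$. A subgroup $H$ of a group $G$ is verbally closed in $G$ if every equation of the form $w(x_1,\dots,x_r)=h$, where $w$ is an element of the free group $F(x_1,\dots,x_r)$ and $h\in H$, has a solution in $G$ if and only if it has a solution in $H$. A subgroup $H$ of $G$ is algebraically closed in $G$ if every finite system of equations $\{w_1(x_1,\dots,x_r)=1,\dots,w_m(x_1,\dots,x_r)=1\}$ with coefficients from $H$, i.e. with $w_i\in H*F(x_1,\dots,x_r)$ (free product), has a solution in $G$ if and only if it has a solution in $H$. A group $H$ is strongly verbally closed if it is algebraically closed in every group containing $H$ as a verbally closed subgroup. *)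

theory Defs
  imports "HOL-Algebra.Algebra"
begin

definition centralizer :: "('a, 'm) monoid_scheme \<Rightarrow> 'a set \<Rightarrow> 'a set" where
  "centralizer G S = {g \<in> carrier G. \<forall>s\<in>S. g \<otimes>\<^bsub>G\<^esub> s = s \<otimes>\<^bsub>G\<^esub> g}"

definition center :: "('a, 'm) monoid_scheme \<Rightarrow> 'a set" where
  "center G = {z \<in> carrier G. \<forall>g\<in>carrier G. z \<otimes>\<^bsub>G\<^esub> g = g \<otimes>\<^bsub>G\<^esub> z}"

definition group_commutator :: "('a, 'm) monoid_scheme \<Rightarrow> 'a \<Rightarrow> 'a \<Rightarrow> 'a" where
  "group_commutator G x y = inv\<^bsub>G\<^esub> x \<otimes>\<^bsub>G\<^esub> inv\<^bsub>G\<^esub> y \<otimes>\<^bsub>G\<^esub> x \<otimes>\<^bsub>G\<^esub> y"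

definition finitely_generated_group :: "('a, 'm) monoid_scheme \<Rightarrow> bool" where
  "finitely_generated_group G \<longleftrightarrow>
     group G \<and> (\<exists>S. finite S \<and> S \<subseteq> carrier G \<and> generate G S = carrier G)"

text \<open>
  \<open>Var i\<close> and \<open>VarInv i\<close> stand for the unknown \<open>x\<^sub>i\<close> and its formal inverse, \<open>Coef c\<close> for a
  coefficient. An element of the free product \<open>A * F(x\<^sub>0,\<dots>,x\<^bsub>r-1\<^esub>)\<close> is given by
  any word representing it, i.e. a member of \<open>eq_words A r\<close>, not necessarily reduced. Solutions of an
  equation depend only on the element represented, since the value of a word under an assignment
  is its image under the induced homomorphism. Elements of the free group itself are the words
  without coefficients, \<open>eq_words {} r\<close>.
\<close>

datatype 'a letter = Coef 'a | Var nat | VarInv nat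

definition eq_words :: "'a set \<Rightarrow> nat \<Rightarrow> 'a letter list set" where
  "eq_words A r = lists (Coef ` A \<union> Var ` {..<r} \<union> VarInv ` {..<r})"

fun letter_value :: "('a, 'm) monoid_scheme \<Rightarrow> (nat \<Rightarrow> 'a) \<Rightarrow> 'a letter \<Rightarrow> 'a" where
  "letter_value G x (Coef c) = c"
| "letter_value G x (Var i) = x i"
| "letter_value G x (VarInv i) = inv\<^bsub>G\<^esub> (x i)"

fun word_value :: "('a, 'm) monoid_scheme \<Rightarrow> (nat \<Rightarrow> 'a) \<Rightarrow> 'a letter list \<Rightarrow> 'a" where
  "word_value G x [] = \<one>\<^bsub>G\<^esub>"
| "word_value G x (l # w) = letter_value G x l \<otimes>\<^bsub>G\<^esub> word_value G x w"

definition verbally_closed :: "'a set \<Rightarrow> ('a, 'm) monoid_scheme \<Rightarrow> bool" where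
  "verbally_closed H G \<longleftrightarrow> subgroup H G \<and>
     (\<forall>r. \<forall>w \<in> eq_words {} r. \<forall>h\<in>H.
        (\<exists>x \<in> {..<r} \<rightarrow> carrier G. word_value G x w = h) \<longleftrightarrow>
        (\<exists>x \<in> {..<r} \<rightarrow> H. word_value G x w = h))"

definition algebraically_closed :: "'a set \<Rightarrow> ('a, 'm) monoid_scheme \<Rightarrow> bool" where
  "algebraically_closed H G \<longleftrightarrow> subgroup H G \<and>
     (\<forall>r. \<forall>W. finite W \<and> W \<subseteq> eq_words H r \<longrightarrow>
        ((\<exists>x \<in> {..<r} \<rightarrow> carrier G. \<forall>w\<in>W. word_value G x w = \<one>\<^bsub>G\<^esub>) \<longleftrightarrow>
         (\<exists>x \<in> {..<r} \<rightarrow> H. \<forall>w\<in>W. word_value G x w = \<one>\<^bsub>G\<^esub>)))"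

text \<open>
  A group containing \<open>H\<close> is a group \<open>G\<close> with an injective homomorphism \<open>\<phi>\<close> from \<open>H\<close>.
  A definition in HOL cannot quantify over the type of the elements of \<open>G\<close>, so they are taken from
  the type of words with coefficients in \<open>H\<close>. This is no restriction: the theorem
  \<open>strongly_verbally_closedD\<close> below gives the same conclusion for \<open>G\<close> over an arbitrary type.
\<close>

definition strongly_verbally_closed :: "('a, 'm) monoid_scheme \<Rightarrow> bool" where
  "strongly_verbally_closed H \<longleftrightarrow> group H \<and>
     (\<forall>(G :: 'a letter list monoid) \<phi>.
        group G \<and> \<phi> \<in> hom H G \<and> inj_on \<phi> (carrier H) \<and>
        verbally_closed (\<phi> ` carrier H) G \<longrightarrow> algebraically_closed (\<phi> ` carrier H) G)"

lemma letter_value_hom: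
  assumes "group P" "group G" "\<psi> \<in> hom P G" "x \<in> {..<r} \<rightarrow> carrier P"
    and "l \<in> Coef ` carrier P \<union> Var ` {..<r} \<union> VarInv ` {..<r}"
  shows "letter_value P x l \<in> carrier P \<and>
         letter_value G (\<lambda>i. \<psi> (x i)) (map_letter \<psi> l) = \<psi> (letter_value P x l)"
proof -
  interpret group_hom P G \<psi>
    using assms(1-3) by (simp add: group_hom_def group_hom_axioms_def)
  show ?thesis
    using assms(4,5) by (auto simp: Pi_iff)
qed

lemma word_value_hom:
  assumes "group P" "group G" "\<psi> \<in> hom P G" "x \<in> {..<r} \<rightarrow> carrier P"
    and "w \<in> eq_words (carrier P) r"
  shows "word_value P x w \<in> carrier P \<and>
         word_value G (\<lambda>i. \<psi> (x i)) (map (map_letter \<psi>) w) = \<psi> (word_value P x w)"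
proof -
  interpret group_hom P G \<psi>
    using assms(1-3) by (simp add: group_hom_def group_hom_axioms_def)
  from assms(5) show ?thesis unfolding eq_words_def
  proof (induction w)
    case Nil
    then show ?case by simp
  next
    case (Cons l w)
    with letter_value_hom[OF assms(1-4), of l] show ?case by simp
  qed
qed

lemma eq_words_mono: "A \<subseteq> B \<Longrightarrow> eq_words A r \<subseteq> eq_words B r"
  unfolding eq_words_def by (intro lists_mono) auto

lemma eq_words_map:
  "w \<in> eq_words A r \<Longrightarrow> map (map_letter f) w \<in> eq_words (f ` A) r"
  unfolding eq_words_def by (induction w) auto

lemma eq_words_map_cong:
  "w \<in> eq_words A r \<Longrightarrow> (\<And>a. a \<in> A \<Longrightarrow> f a = g a) \<Longrightarrow>
   map (map_letter f) w = map (map_letter g) w"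
  unfolding eq_words_def by (induction w) auto

lemma word_value_cong:
  "w \<in> eq_words A r \<Longrightarrow> (\<And>i. i < r \<Longrightarrow> x i = y i) \<Longrightarrow> word_value G x w = word_value G y w"
  unfolding eq_words_def by (induction w) auto

lemma word_value_append:
  assumes "group G" "x \<in> {..<r} \<rightarrow> carrier G" "v \<in> eq_words (carrier G) r" "w \<in> eq_words (carrier G) r"
  shows "word_value G x (v @ w) = word_value G x v \<otimes>\<^bsub>G\<^esub> word_value G x w"
proof -
  interpret group G by fact
  have id: "id \<in> hom G G" by (simp add: hom_def)
  note L = letter_value_hom[OF assms(1,1) id assms(2)] and W = word_value_hom[OF assms(1,1) id assms(2)]
  from assms(3) show ?thesis unfolding eq_words_def
  proof (induction v)
    case Nil
    then show ?case using W[OF assms(4)] by simp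
  next
    case (Cons l v)
    then show ?case using L[of l] W[OF assms(4)] W[of v] by (simp add: m_assoc eq_words_def)
  qed
qed

lemma verbally_closed_transport:
  fixes P :: "('a, 'm) monoid_scheme" and G :: "('b, 'n) monoid_scheme"
  assumes "group P" "group G" "\<psi> \<in> hom P G" "inj_on \<psi> (carrier P)" "subgroup M P"
    and "verbally_closed (\<psi> ` M) G"
  shows "verbally_closed M P"
  unfolding verbally_closed_def
proof (intro conjI allI ballI iffI)
  note MP = subgroup.subset[OF assms(5)]
  fix r and w :: "'a letter list" and h
  assume w: "w \<in> eq_words {} r" and h: "h \<in> M"
  have wP: "w \<in> eq_words (carrier P) r" using w eq_words_mono[of "{}" "carrier P" r] by auto
  note W = word_value_hom[OF assms(1-3) _ wP]
  define w' where "w' = map (map_letter \<psi>) w"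
  have w': "w' \<in> eq_words {} r" using eq_words_map[OF w, of \<psi>] by (simp add: w'_def)
  note W = W[folded w'_def]
  {
    assume "\<exists>x \<in> {..<r} \<rightarrow> M. word_value P x w = h"
    with MP show "\<exists>x \<in> {..<r} \<rightarrow> carrier P. word_value P x w = h" by blast
  }
  assume "\<exists>x \<in> {..<r} \<rightarrow> carrier P. word_value P x w = h"
  then obtain x where x: "x \<in> {..<r} \<rightarrow> carrier P" "word_value P x w = h" by auto
  have "(\<lambda>i. \<psi> (x i)) \<in> {..<r} \<rightarrow> carrier G" using x(1) assms(3) by (auto simp: hom_def Pi_iff)
  with W[OF x(1)] x(2) have "\<exists>x \<in> {..<r} \<rightarrow> carrier G. word_value G x w' = \<psi> h" by auto
  with assms(6) w' h have "\<exists>y \<in> {..<r} \<rightarrow> \<psi> ` M. word_value G y w' = \<psi> h"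
    unfolding verbally_closed_def by blast
  then obtain y where y: "y \<in> {..<r} \<rightarrow> \<psi> ` M" "word_value G y w' = \<psi> h" by auto
  define z where "z i = inv_into M \<psi> (y i)" for i
  have z: "z \<in> {..<r} \<rightarrow> M" and zy: "\<And>i. i < r \<Longrightarrow> \<psi> (z i) = y i"
    using y(1) by (auto simp: z_def Pi_iff inv_into_into f_inv_into_f)
  have zP: "z \<in> {..<r} \<rightarrow> carrier P" using z MP by auto
  have "\<psi> (word_value P z w) = word_value G y w'"
    using W[OF zP] word_value_cong[OF w', of "\<lambda>i. \<psi> (z i)" y G] zy by simp
  with y(2) W[OF zP] h MP have "word_value P z w = h"
    using inj_onD[OF assms(4), of "word_value P z w" h] by auto
  with z show "\<exists>x \<in> {..<r} \<rightarrow> M. word_value P x w = h" by blast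
qed (fact assms)

lemma algebraically_closed_transport:
  assumes "group P" "group G" "\<psi> \<in> hom P G" "inj_on \<psi> (carrier P)"
    and "algebraically_closed M P"
    and W: "finite W" "W \<subseteq> eq_words (\<psi> ` M) r"
    and x: "x \<in> {..<r} \<rightarrow> \<psi> ` carrier P" "\<forall>w\<in>W. word_value G x w = \<one>\<^bsub>G\<^esub>"
  shows "\<exists>y \<in> {..<r} \<rightarrow> \<psi> ` M. \<forall>w\<in>W. word_value G y w = \<one>\<^bsub>G\<^esub>"
proof -
  interpret group_hom P G \<psi>
    using assms(1-3) by (simp add: group_hom_def group_hom_axioms_def)
  have sub: "subgroup M P" using assms(5) by (simp add: algebraically_closed_def)
  note MP = subgroup.subset[OF sub]
  define f where "f = map (map_letter (inv_into M \<psi>))"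
  have fw: "f w \<in> eq_words M r" "map (map_letter \<psi>) (f w) = w" if "w \<in> W" for w
  proof -
    have w: "w \<in> eq_words (\<psi> ` M) r" using that W by auto
    have "inv_into M \<psi> ` \<psi> ` M \<subseteq> M" by (auto intro: inv_into_into)
    then show "f w \<in> eq_words M r"
      unfolding f_def using eq_words_map[OF w] eq_words_mono by blast
    have "map (map_letter \<psi>) (f w) = map (map_letter (\<psi> \<circ> inv_into M \<psi>)) w"
      by (simp add: f_def letter.map_comp)
    also have "\<dots> = map (map_letter id) w"
      using w by (rule eq_words_map_cong) (simp add: f_inv_into_f)
    finally show "map (map_letter \<psi>) (f w) = w" by (simp add: letter.map_id0)
  qed
  have fwP: "f w \<in> eq_words (carrier P) r" if "w \<in> W" for w
    using fw(1)[OF that] eq_words_mono[OF MP] by blast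
  define x' where "x' i = inv_into (carrier P) \<psi> (x i)" for i
  have x': "x' \<in> {..<r} \<rightarrow> carrier P" "\<And>i. i < r \<Longrightarrow> \<psi> (x' i) = x i"
    using x(1) by (auto simp: x'_def Pi_iff inv_into_into f_inv_into_f)
  have "word_value P x' v = \<one>\<^bsub>P\<^esub>" if "v \<in> f ` W" for v
  proof -
    from that obtain w where w: "w \<in> W" "v = f w" by auto
    note V = word_value_hom[OF assms(1-3) x'(1) fwP[OF w(1)], unfolded fw(2)[OF w(1)]]
    have "word_value G (\<lambda>i. \<psi> (x' i)) w = word_value G x w"
      using W(2) w(1) x'(2) by (blast intro: word_value_cong)
    with V x(2) w have "\<psi> (word_value P x' v) = \<psi> \<one>\<^bsub>P\<^esub>" "word_value P x' v \<in> carrier P" by auto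
    with inj_onD[OF assms(4), of "word_value P x' v" "\<one>\<^bsub>P\<^esub>"] show ?thesis by auto
  qed
  with x'(1) have "\<exists>x \<in> {..<r} \<rightarrow> carrier P. \<forall>w \<in> f ` W. word_value P x w = \<one>\<^bsub>P\<^esub>" by blast
  moreover have "finite (f ` W) \<and> f ` W \<subseteq> eq_words M r" using W(1) fw(1) by auto
  ultimately have "\<exists>x \<in> {..<r} \<rightarrow> M. \<forall>w \<in> f ` W. word_value P x w = \<one>\<^bsub>P\<^esub>"
    using assms(5) unfolding algebraically_closed_def by blast
  then obtain y where y: "y \<in> {..<r} \<rightarrow> M" "\<forall>w \<in> f ` W. word_value P y w = \<one>\<^bsub>P\<^esub>" by auto
  have yP: "y \<in> {..<r} \<rightarrow> carrier P" using y(1) MP by auto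
  show ?thesis
  proof (intro bexI ballI)
    show "(\<lambda>i. \<psi> (y i)) \<in> {..<r} \<rightarrow> \<psi> ` M" using y(1) by auto
    fix w assume w: "w \<in> W"
    show "word_value G (\<lambda>i. \<psi> (y i)) w = \<one>\<^bsub>G\<^esub>"
      using word_value_hom[OF assms(1-3) yP fwP[OF w], unfolded fw(2)[OF w]] y(2) w by simp
  qed
qed

lemma subgroup_word_values:
  fixes G (structure)
  assumes "group G" "subgroup N G" "x \<in> {..<r} \<rightarrow> carrier G"
  shows "subgroup (word_value G x ` eq_words N r) G"
proof -
  interpret group G by fact
  note NG = subgroup.subset[OF assms(2)]
  have id: "id \<in> hom G G" by (simp add: hom_def)
  have C: "word_value G x w \<in> carrier G" "w \<in> eq_words (carrier G) r" if "w \<in> eq_words N r" for w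
    using word_value_hom[OF assms(1,1) id assms(3), of w] that eq_words_mono[OF NG] by blast+
  have app: "word_value G x (v @ w) = word_value G x v \<otimes> word_value G x w" "v @ w \<in> eq_words N r"
    if "v \<in> eq_words N r" "w \<in> eq_words N r" for v w
    using word_value_append[OF assms(1,3)] C that by (auto simp: eq_words_def)
  have single: "\<exists>l'. [l'] \<in> eq_words N r \<and> word_value G x [l'] = inv (word_value G x [l])"
    if "[l] \<in> eq_words N r" for l
  proof -
    have "l \<in> Coef ` N \<union> Var ` {..<r} \<union> VarInv ` {..<r}" using that by (simp add: eq_words_def)
    then consider c where "l = Coef c" "c \<in> N" | i where "l = Var i" "i < r" | i where "l = VarInv i" "i < r"
      by blast
    then show ?thesis
    proof cases
      case 1
      then show ?thesis using subgroup.m_inv_closed[OF assms(2)] NG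
        by (intro exI[of _ "Coef (inv c)"]) (auto simp: eq_words_def)
    next
      case 2
      then show ?thesis using assms(3)
        by (intro exI[of _ "VarInv i"]) (auto simp: eq_words_def Pi_iff)
    next
      case 3
      then show ?thesis using assms(3)
        by (intro exI[of _ "Var i"]) (auto simp: eq_words_def Pi_iff)
    qed
  qed
  have "\<exists>v \<in> eq_words N r. word_value G x v = inv (word_value G x w)" if "w \<in> eq_words N r" for w
    using that
  proof (induction w)
    case Nil
    show ?case by (intro bexI[of _ "[]"]) (auto simp: eq_words_def)
  next
    case (Cons l w)
    have l: "[l] \<in> eq_words N r" and w: "w \<in> eq_words N r" using Cons.prems by (auto simp: eq_words_def)
    obtain v where v: "v \<in> eq_words N r" "word_value G x v = inv (word_value G x w)"
      using Cons.IH[OF w] by auto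
    obtain l' where l': "[l'] \<in> eq_words N r" "word_value G x [l'] = inv (word_value G x [l])"
      using single[OF l] by auto
    have "word_value G x (l # w) = word_value G x [l] \<otimes> word_value G x w"
      using app(1)[OF l w] by simp
    then have "inv (word_value G x (l # w)) = word_value G x (v @ [l'])"
      using app(1)[OF v(1) l'(1)] v(2) l'(2) C(1)[OF l] C(1)[OF w] by (simp only: inv_mult_group)
    with app(2)[OF v(1) l'(1)] show ?case
      by (intro bexI[of _ "v @ [l']"]) simp_all
  qed
  note inverse = this
  show ?thesis
  proof (rule subgroupI)
    show "word_value G x ` eq_words N r \<subseteq> carrier G" using C by auto
    show "word_value G x ` eq_words N r \<noteq> {}" by (auto simp: eq_words_def)
    show "inv a \<in> word_value G x ` eq_words N r" if "a \<in> word_value G x ` eq_words N r" for a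
      using inverse that by (force simp: image_iff)
    show "a \<otimes> b \<in> word_value G x ` eq_words N r"
      if "a \<in> word_value G x ` eq_words N r" "b \<in> word_value G x ` eq_words N r" for a b
    proof -
      from that obtain v w where "v \<in> eq_words N r" "a = word_value G x v"
        "w \<in> eq_words N r" "b = word_value G x w" by auto
      with app[of v w] show ?thesis by (intro image_eqI[of _ _ "v @ w"]) simp_all
    qed
  qed
qed

theorem strongly_verbally_closedD:
  fixes H :: "('a, 'm) monoid_scheme" and G :: "('b, 'n) monoid_scheme" (structure)
  assumes svc: "strongly_verbally_closed H"
    and G: "group G" and \<phi>: "\<phi> \<in> hom H G" "inj_on \<phi> (carrier H)"
    and vc: "verbally_closed (\<phi> ` carrier H) G"
  shows "algebraically_closed (\<phi> ` carrier H) G"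
proof -
  interpret group G by fact
  define N where "N = \<phi> ` carrier H"
  have sub: "subgroup N G" using vc by (simp add: verbally_closed_def N_def)
  note NG = subgroup.subset[OF sub]
  have main: "\<exists>y \<in> {..<r} \<rightarrow> N. \<forall>w\<in>W. word_value G y w = \<one>"
    if W: "finite W" "W \<subseteq> eq_words N r"
      and x: "x \<in> {..<r} \<rightarrow> carrier G" "\<forall>w\<in>W. word_value G x w = \<one>" for r W x
  proof -
    define K where "K = word_value G x ` eq_words N r"
    have subK: "subgroup K G" unfolding K_def by (rule subgroup_word_values[OF G sub x(1)])
    define G' where "G' = G\<lparr>carrier := K\<rparr>"
    have G': "group G'" using subgroup.subgroup_is_group[OF subK G] by (simp add: G'_def)
    have KG: "K \<subseteq> carrier G" using subgroup.subset[OF subK] .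
    have NK: "N \<subseteq> K"
    proof
      fix a assume a: "a \<in> N"
      then have "word_value G x [Coef a] = a" using NG by auto
      moreover have "[Coef a] \<in> eq_words N r" using a by (simp add: eq_words_def)
      ultimately show "a \<in> K" unfolding K_def by (intro image_eqI[of _ _ "[Coef a]"]) simp_all
    qed
    have xK: "x i \<in> K" if "i < r" for i
    proof -
      have "word_value G x [Var i] = x i" using that x(1) by (auto simp: Pi_iff)
      moreover have "[Var i] \<in> eq_words N r" using that by (simp add: eq_words_def)
      ultimately show "x i \<in> K" unfolding K_def by (intro image_eqI[of _ _ "[Var i]"]) simp_all
    qed
    define c :: "'b \<Rightarrow> 'a letter list" where
      "c g = map (map_letter (inv_into (carrier H) \<phi>)) (SOME v. v \<in> eq_words N r \<and> word_value G x v = g)" for g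
    have c: "word_value G x (map (map_letter \<phi>) (c g)) = g" if "g \<in> K" for g
    proof -
      define v where "v = (SOME v. v \<in> eq_words N r \<and> word_value G x v = g)"
      have "\<exists>v. v \<in> eq_words N r \<and> word_value G x v = g" using that by (auto simp: K_def)
      then have v: "v \<in> eq_words N r" "word_value G x v = g"
        unfolding v_def using someI_ex[of "\<lambda>v. v \<in> eq_words N r \<and> word_value G x v = g"] by auto
      have "map (map_letter \<phi>) (c g) = map (map_letter (\<phi> \<circ> inv_into (carrier H) \<phi>)) v"
        by (simp add: c_def v_def letter.map_comp)
      also have "\<dots> = map (map_letter id) v"
        using v(1) by (rule eq_words_map_cong) (simp add: N_def f_inv_into_f)
      finally show ?thesis using v(2) by (simp add: letter.map_id0)
    qed
    have inj_c: "inj_on c (carrier G')"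
    proof (rule inj_onI)
      fix g h assume "g \<in> carrier G'" "h \<in> carrier G'" and eq: "c g = c h"
      then have K: "g \<in> K" "h \<in> K" by (simp_all add: G'_def)
      show "g = h" using trans[OF sym[OF c[OF K(1), unfolded eq]] c[OF K(2)]] .
    qed
    define P where "P = image_group c G'"
    have P: "group P" unfolding P_def using group.inj_imp_image_group_is_group[OF G' inj_c] .
    have iso: "c \<in> iso G' P" unfolding P_def using inj_imp_image_group_iso[OF inj_c] .
    define \<psi> where "\<psi> = inv_into (carrier G') c"
    have iso': "\<psi> \<in> iso P G'" unfolding \<psi>_def using group.iso_set_sym[OF G' iso] .
    have carG': "carrier G' = K" by (simp add: G'_def)
    have \<psi>_im: "\<psi> ` carrier P = K" and \<psi>_inj: "inj_on \<psi> (carrier P)"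
      using iso' by (auto simp: iso_def bij_betw_def carG')
    have \<psi>_hom: "\<psi> \<in> hom P G"
      using iso' KG by (auto simp: iso_def hom_def G'_def Pi_iff)
    have \<psi>c: "\<psi> (c g) = g" if "g \<in> K" for g
      using that inj_c by (simp add: \<psi>_def carG' inv_into_f_f)
    have \<phi>': "c \<circ> \<phi> \<in> hom H P"
    proof -
      have "\<phi> \<in> hom H G'" using \<phi>(1) NK by (auto simp: hom_def G'_def N_def Pi_iff)
      moreover have "c \<in> hom G' P" using iso by (simp add: iso_def)
      ultimately show ?thesis by (auto simp: hom_def Pi_iff)
    qed
    have inj': "inj_on (c \<circ> \<phi>) (carrier H)"
      using comp_inj_on[OF \<phi>(2) inj_on_subset[OF inj_c]] NK by (simp add: N_def carG')
    define M where "M = (c \<circ> \<phi>) ` carrier H"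
    have \<psi>M: "\<psi> ` M = N" 
    proof -
      have "\<psi> ` M = (\<lambda>g. \<psi> (c g)) ` N" by (simp add: M_def N_def image_image)
      also have "\<dots> = (\<lambda>g. g) ` N" using NK \<psi>c by (intro image_cong refl) auto
      finally show ?thesis by simp
    qed
    have H: "group H" using svc by (simp add: strongly_verbally_closed_def)
    have subM: "subgroup M P"
      unfolding M_def using group_hom.img_is_subgroup[OF group_hom.intro[OF H P group_hom_axioms.intro[OF \<phi>']]] .
    have "verbally_closed M P"
      using verbally_closed_transport[OF P G \<psi>_hom \<psi>_inj subM] vc by (simp add: \<psi>M N_def)
    then have "algebraically_closed M P"
      using svc P \<phi>' inj' unfolding strongly_verbally_closed_def M_def by blast
    moreover have "x \<in> {..<r} \<rightarrow> \<psi> ` carrier P" using xK by (simp add: \<psi>_im Pi_iff)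
    ultimately show ?thesis
      using algebraically_closed_transport[OF P G \<psi>_hom \<psi>_inj _ W(1), of M r x] W(2) x(2)
      by (simp add: \<psi>M)
  qed
  show ?thesis
    unfolding algebraically_closed_def N_def[symmetric]
  proof (intro conjI allI impI iffI)
    fix r W assume W: "finite W \<and> W \<subseteq> eq_words N r"
    {
      assume "\<exists>x \<in> {..<r} \<rightarrow> carrier G. \<forall>w\<in>W. word_value G x w = \<one>"
      then obtain x where "x \<in> {..<r} \<rightarrow> carrier G" "\<forall>w\<in>W. word_value G x w = \<one>" by auto
      with main[of W r x] W show "\<exists>x \<in> {..<r} \<rightarrow> N. \<forall>w\<in>W. word_value G x w = \<one>" by simp
    next
      assume "\<exists>x \<in> {..<r} \<rightarrow> N. \<forall>w\<in>W. word_value G x w = \<one>"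
      then obtain x where "x \<in> {..<r} \<rightarrow> N" "\<forall>w\<in>W. word_value G x w = \<one>" by auto
      with NG show "\<exists>x \<in> {..<r} \<rightarrow> carrier G. \<forall>w\<in>W. word_value G x w = \<one>"
        by (intro bexI[of _ x]) auto
    }
  qed (fact sub)
qed

end

theory Submission
  imports Defs "HOL-Library.Ramsey"
begin

text \<open>
  Put \<open>q = p\<^sup>k\<close> and \<open>c = b\<^sup>q\<close>. Inside a power \<open>H\<^sup>t\<close> the diagonal copy of \<open>H\<close> lies in the product of the
  \<open>t\<close> commuting coordinate subgroups. Adjoin to \<open>H\<^sup>t\<close> central \<open>q\<close>-th roots \<open>v\<^sub>i\<close> of the elements equal to \<open>c\<close>
  in the coordinates \<open>y\<close> with \<open>e i y\<close> and trivial elsewhere. If a word takes the value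
  \<open>h\<close> on the diagonal, then its value in coordinate \<open>y\<close> is \<open>h\<close> up to a power of \<open>c\<close> with exponent
  \<open>\<Sum>\<^sub>i s\<^sub>i e(i, y)\<close>, so the diagonal is verbally closed as soon as each such integer combination
  vanishes modulo \<open>q\<close> in some coordinate. A Ramsey argument
  yields incidences \<open>e\<close> with this property for which, moreover, every set of at most \<open>n\<close> coordinates
  is contained in one of the sets \<open>{y. e i y}\<close>.

  Since \<open>H\<close> is algebraically closed in this group, \<open>H\<close> itself has commuting subgroups \<open>K\<^sub>y\<close> with
  product \<open>H\<close>, elements \<open>b\<^sub>y \<in> K\<^sub>y\<close> with product \<open>b\<close>, and central \<open>v\<^sub>i\<close> with
  \<open>(\<Prod>\<^bsub>e i y\<^esub> b\<^sub>y)\<^sup>q = v\<^sub>i\<^sup>q\<close>. If \<open>K\<^sub>y\<close> centralises the set in question, which contains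
  \<open>(\<Prod>\<^bsub>e i y\<^esub> b\<^sub>y) v\<^sub>i\<^sup>-\<^sup>1\<close>, then \<open>b\<^sub>y\<close> is central. If fewer than \<open>n\<close> of the \<open>K\<^sub>y\<close> failed to do so, some
  \<open>e i\<close> would cover all of those, and \<open>b\<^sup>q\<close> would be the \<open>q\<close>-th power of a central element.
\<close>

section \<open>Combinatorics of hitting sets\<close>

text \<open>Ramsey's theorem is iterated over the exponent: a set homogeneous for exponents up to
  \<open>d\<close> is taken as large as the Ramsey number for exponent \<open>Suc d\<close>, and
  passing to a subset keeps the smaller exponents homogeneous. Hence \<open>L\<close> is arbitrary
  in the induction.\<close>

lemma ramsey_all_exponents:
  fixes q L d :: nat
  shows "\<exists>M. \<forall>f :: nat set \<Rightarrow> nat. (\<forall>B. f B < q) \<longrightarrow>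
    (\<exists>Y\<subseteq>{..<M}. card Y = L \<and> (\<forall>r\<le>d. \<exists>\<gamma>. \<forall>B\<subseteq>Y. card B = r \<longrightarrow> f B = \<gamma>))"
proof (induction d arbitrary: L)
  case 0
  have "f B = f {}" if "B \<subseteq> {..<L}" "card B = 0" for f :: "nat set \<Rightarrow> nat" and B
    using that finite_subset[of B "{..<L}"] by simp
  then show ?case by (intro exI[of _ L]) (auto intro!: exI[of _ "{..<L}"])
next
  case (Suc d)
  obtain N :: nat where N: "partn_lst {..<N} (replicate q L) (Suc d)" using ramsey_full by blast
  obtain M where M: "\<forall>f :: nat set \<Rightarrow> nat. (\<forall>B. f B < q) \<longrightarrow>
    (\<exists>Y\<subseteq>{..<M}. card Y = N \<and> (\<forall>r\<le>d. \<exists>\<gamma>. \<forall>B\<subseteq>Y. card B = r \<longrightarrow> f B = \<gamma>))"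
    using Suc[of N] ..
  show ?case
  proof (intro exI[of _ M] allI impI)
    fix f :: "nat set \<Rightarrow> nat" assume f: "\<forall>B. f B < q"
    obtain Y where Y: "Y \<subseteq> {..<M}" "card Y = N" "\<And>r. r \<le> d \<Longrightarrow> \<exists>\<gamma>. \<forall>B\<subseteq>Y. card B = r \<longrightarrow> f B = \<gamma>"
      using M f by blast
    have "finite Y" using Y(1) finite_subset by blast
    \<comment> \<open>\<open>h\<close> transfers the colouring from \<open>Y\<close> to
      \<open>{..<N}\<close>, the set for which \<open>N\<close> is a Ramsey number.\<close>
    then obtain h where h: "bij_betw h {..<N} Y"
      using ex_bij_betw_nat_finite[of Y] Y(2) by (auto simp: atLeast0LessThan)
    have "(\<lambda>B. f (h ` B)) \<in> nsets {..<N} (Suc d) \<rightarrow> {..<length (replicate q L)}" using f by simp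
    with N have "\<exists>i<length (replicate q L). monochromatic {..<N} (replicate q L ! i) (Suc d) (\<lambda>B. f (h ` B)) i"
      unfolding partn_lst_def by (rule bspec)
    then obtain i K where K: "K \<in> nsets {..<N} L" "(\<lambda>B. f (h ` B)) ` nsets K (Suc d) \<subseteq> {i}"
      unfolding monochromatic_def by auto
    have KN: "K \<subseteq> {..<N}" "card K = L" using K(1) by (auto simp: nsets_def)
    have inj: "inj_on h K" using h KN(1) by (meson bij_betw_imp_inj_on inj_on_subset)
    have hK: "h ` K \<subseteq> Y" using h KN(1) by (auto simp: bij_betw_def)
    have top: "f B = i" if B: "B \<subseteq> h ` K" "card B = Suc d" for B
    proof -
      obtain B' where B': "B' \<subseteq> K" "B = h ` B'" using B(1) unfolding subset_image_iff by auto
      have "card B' = Suc d" using card_image[OF inj_on_subset[OF inj B'(1)]] B(2) B'(2) by simp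
      then have "B' \<in> nsets K (Suc d)"
        using B'(1) card.infinite[of B'] by (cases "finite B'") (auto simp: nsets_def)
      then show ?thesis using K(2) B'(2) by auto
    qed
    have "\<exists>\<gamma>. \<forall>B\<subseteq>h ` K. card B = r \<longrightarrow> f B = \<gamma>" if "r \<le> Suc d" for r
    proof (cases "r = Suc d")
      case True
      then show ?thesis using top by blast
    next
      case False
      then obtain \<gamma> where "\<forall>B\<subseteq>Y. card B = r \<longrightarrow> f B = \<gamma>" using \<open>r \<le> Suc d\<close> Y(3)[of r] by auto
      then show ?thesis using hK by (intro exI[of _ \<gamma>]) auto
    qed
    moreover have "h ` K \<subseteq> {..<M}" "card (h ` K) = L"
      using hK Y(1) KN(2) inj by (auto simp: card_image)
    ultimately show "\<exists>Y\<subseteq>{..<M}. card Y = L \<and> (\<forall>r\<le>Suc d. \<exists>\<gamma>. \<forall>B\<subseteq>Y. card B = r \<longrightarrow> f B = \<gamma>)"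
      by blast
  qed
qed

text \<open>Absorption \<open>r * (n choose r) = n * ((n - 1) choose (r - 1))\<close> with
  \<open>n = q * fact d\<close>: since \<open>r\<close> divides \<open>fact d\<close>, the factor
  \<open>q\<close> survives the cancellation of \<open>r\<close>.\<close>

lemma dvd_choose_mult_fact:
  fixes q d r :: nat
  assumes "1 \<le> r" "r \<le> d"
  shows "q dvd (q * fact d) choose r"
proof -
  obtain e where e: "fact d = r * e" using dvd_fact[OF assms] by (auto elim: dvdE)
  have "r * ((q * fact d) choose r) = (q * fact d) * ((q * fact d - 1) choose (r - 1))"
    using times_binomial_minus1_eq[of r "q * fact d"] assms by simp
  also have "\<dots> = r * (q * e * ((q * fact d - 1) choose (r - 1)))" by (simp add: e)
  finally have "(q * fact d) choose r = q * e * ((q * fact d - 1) choose (r - 1))"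
    using assms by simp
  then show ?thesis by simp
qed

text \<open>Inclusion-exclusion: the product over \<open>x \<in> I\<close> of one minus the
  indicator of \<open>x \<in> y\<close> indicates that \<open>I\<close> misses \<open>y\<close>; it
  is expanded over the subsets \<open>B\<close> of \<open>I\<close>, and the empty one cancels
  against 1.\<close>

lemma of_bool_meets_eq_sum:
  fixes I y :: "'a set"
  assumes "finite I"
  shows "(of_bool (I \<inter> y \<noteq> {}) :: int) = (\<Sum>B\<in>Pow I - {{}}. - ((-1) ^ card B) * of_bool (B \<subseteq> y))"
proof -
  have "(of_bool (I \<inter> y = {}) :: int) = (\<Prod>x\<in>I. 1 - of_bool (x \<in> y))"
    using assms by (auto simp: disjoint_iff intro!: prod.neutral[symmetric])
  also have "\<dots> = (\<Sum>B\<in>Pow I. (-1) ^ card B * of_bool (B \<subseteq> y))"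
    unfolding prod_diff_conv_sum[OF assms]
  proof (rule sum.cong[OF refl])
    fix B assume "B \<in> Pow I"
    then have "finite B" using assms finite_subset by auto
    then have "(\<Prod>x\<in>B. of_bool (x \<in> y)) = (of_bool (B \<subseteq> y) :: int)"
      by (induction B) auto
    then show "(- 1) ^ card B * (\<Prod>x\<in>B. of_bool (x \<in> y)) * (\<Prod>x\<in>I - B. 1) =
        ((- 1) ^ card B * of_bool (B \<subseteq> y) :: int)" by simp
  qed
  finally have "(of_bool (I \<inter> y = {}) :: int) = (\<Sum>B\<in>Pow I. (-1) ^ card B * of_bool (B \<subseteq> y))" .
  moreover have "(\<Sum>B\<in>Pow I. (-1) ^ card B * of_bool (B \<subseteq> y)) =
      (1::int) + (\<Sum>B\<in>Pow I - {{}}. (-1) ^ card B * of_bool (B \<subseteq> y))"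
    using assms by (subst sum.remove[of _ "{}"]) auto
  moreover have "(of_bool (I \<inter> y \<noteq> {}) :: int) = 1 - of_bool (I \<inter> y = {})"
    by (rule of_bool_not_iff)
  ultimately show ?thesis by (simp add: sum_negf)
qed

text \<open>\<open>M\<close> is chosen before \<open>s\<close>: the incidences have to be fixed
  before any word is known, while the coefficients \<open>s\<close> come from the word.\<close>

lemma hitting_sum_divisible:
  fixes q d :: nat
  assumes "q > 0"
  shows "\<exists>M. \<forall>s :: nat set \<Rightarrow> int. \<exists>y\<subseteq>{..<M}. y \<noteq> {} \<and>
    int q dvd (\<Sum>I | I \<subseteq> {..<M} \<and> card I \<le> d. s I * of_bool (I \<inter> y \<noteq> {}))"
proof -
  obtain M where M: "\<forall>f :: nat set \<Rightarrow> nat. (\<forall>B. f B < q) \<longrightarrow>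
    (\<exists>Y\<subseteq>{..<M}. card Y = q * fact d \<and> (\<forall>r\<le>d. \<exists>\<gamma>. \<forall>B\<subseteq>Y. card B = r \<longrightarrow> f B = \<gamma>))"
    using ramsey_all_exponents[of q "q * fact d" d] ..
  define F where "F = {I. I \<subseteq> {..<M} \<and> card I \<le> d}"
  have finF: "finite F" by (rule finite_subset[of _ "Pow {..<M}"]) (auto simp: F_def)
  show ?thesis
  proof (intro exI[of _ M] allI)
    fix s :: "nat set \<Rightarrow> int"
    \<comment> \<open>In the form \<open>\<Sum>\<^bsub>B \<subseteq> y\<^esub> a B\<close> only subsets of \<open>y\<close> contribute, so a Ramsey set for \<open>a mod q\<close> whose size
      makes the binomial coefficients divisible by \<open>q\<close> works.\<close>
    define a where "a B = - ((-1) ^ card B) * (\<Sum>I\<in>F. s I * of_bool (B \<subseteq> I))" for B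
    have expand: "(\<Sum>I\<in>F. s I * of_bool (I \<inter> y \<noteq> {})) = (\<Sum>B\<in>F - {{}}. a B * of_bool (B \<subseteq> y))" for y
    proof -
      have "of_bool (I \<inter> y \<noteq> {}) = (\<Sum>B\<in>F - {{}}. of_bool (B \<subseteq> I) * (- ((-1) ^ card B) * of_bool (B \<subseteq> y)) :: int)"
        if I: "I \<in> F" for I
      proof -
        have finI: "finite I" using I finite_subset[of I "{..<M}"] by (auto simp: F_def)
        \<comment> \<open>\<open>F\<close> is closed under subsets, so all inner sums can range over
          the same index set \<open>F - {{}}\<close>, which allows the exchange of the two
          sums.\<close>
        have sub: "Pow I - {{}} \<subseteq> F - {{}}"
          using I card_mono[OF finI] le_trans unfolding F_def by blast
        show ?thesis unfolding of_bool_meets_eq_sum[OF finI]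
          using sub finF by (intro sum.mono_neutral_cong_left) auto
      qed
      then have "(\<Sum>I\<in>F. s I * of_bool (I \<inter> y \<noteq> {})) =
          (\<Sum>I\<in>F. \<Sum>B\<in>F - {{}}. s I * (of_bool (B \<subseteq> I) * (- ((-1) ^ card B) * of_bool (B \<subseteq> y))))"
        unfolding sum_distrib_left[symmetric] by (intro sum.cong refl) simp
      also have "\<dots> = (\<Sum>B\<in>F - {{}}. \<Sum>I\<in>F. s I * (of_bool (B \<subseteq> I) * (- ((-1) ^ card B) * of_bool (B \<subseteq> y))))"
        by (rule sum.swap)
      also have "\<dots> = (\<Sum>B\<in>F - {{}}. a B * of_bool (B \<subseteq> y))"
        unfolding a_def sum_distrib_left sum_distrib_right by (intro sum.cong refl) (simp add: ac_simps)
      finally show ?thesis .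
    qed
    have "\<forall>B. nat (a B mod int q) < q" using assms by (simp add: nat_less_iff)
    then obtain Y where Y: "Y \<subseteq> {..<M}" "card Y = q * fact d"
      "\<And>r. r \<le> d \<Longrightarrow> \<exists>\<gamma>. \<forall>B\<subseteq>Y. card B = r \<longrightarrow> nat (a B mod int q) = \<gamma>"
      using M[rule_format, of "\<lambda>B. nat (a B mod int q)"] by blast
    obtain \<gamma> where \<gamma>: "\<And>r B. \<lbrakk>r \<le> d; B \<subseteq> Y; card B = r\<rbrakk> \<Longrightarrow> nat (a B mod int q) = \<gamma> r"
      using Y(3) by metis
    have finY: "finite Y" using Y(1) finite_subset by blast
    define P where "P = {B. B \<subseteq> Y \<and> 1 \<le> card B \<and> card B \<le> d}"
    have finP: "finite P" by (rule finite_subset[of _ "Pow Y"]) (auto simp: P_def finY)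
    have "(\<Sum>I\<in>F. s I * of_bool (I \<inter> Y \<noteq> {})) = (\<Sum>B\<in>P. a B)"
      unfolding expand
    proof (rule sum.mono_neutral_cong_right)
      show "P \<subseteq> F - {{}}" using Y(1) by (auto simp: P_def F_def)
      show "\<forall>B\<in>F - {{}} - P. a B * of_bool (B \<subseteq> Y) = 0"
      proof
        fix B assume B: "B \<in> F - {{}} - P"
        then have "finite B" using finite_subset[of B "{..<M}"] by (auto simp: F_def)
        then have "1 \<le> card B" using B by (simp add: Suc_le_eq card_gt_0_iff)
        then show "a B * of_bool (B \<subseteq> Y) = 0" using B by (auto simp: P_def F_def)
      qed
    qed (use finF in \<open>auto simp: P_def\<close>)
    also have "int q dvd \<dots>"
    proof -
      \<comment> \<open>The sum is sorted by cardinality: modulo \<open>q\<close>, the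
        \<open>r\<close>-subsets of \<open>Y\<close> contribute their number times the common colour
        \<open>\<gamma> r\<close>.\<close>
      have "(\<Sum>B\<in>P. a B) = (\<Sum>r\<in>{1..d}. \<Sum>B\<in>{B\<in>P. card B = r}. a B)"
        using finP by (intro sum.group[symmetric]) (auto simp: P_def)
      moreover have "int q dvd (\<Sum>B\<in>{B\<in>P. card B = r}. a B)" if r: "r \<in> {1..d}" for r
      proof -
        have eq: "{B\<in>P. card B = r} = {B. B \<subseteq> Y \<and> card B = r}" using r by (auto simp: P_def)
        have "(\<Sum>B\<in>{B\<in>P. card B = r}. a B) mod int q = (\<Sum>B\<in>{B\<in>P. card B = r}. a B mod int q) mod int q"
          by (simp add: mod_sum_eq)
        also have "(\<Sum>B\<in>{B\<in>P. card B = r}. a B mod int q) = (\<Sum>B\<in>{B\<in>P. card B = r}. int (\<gamma> r))"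
        proof (rule sum.cong[OF refl])
          fix B assume "B \<in> {B\<in>P. card B = r}"
          then have "nat (a B mod int q) = \<gamma> r" using r by (intro \<gamma>) (auto simp: eq)
          then show "a B mod int q = int (\<gamma> r)" using assms by (metis int_nat_eq pos_mod_sign of_nat_0_less_iff)
        qed
        also have "\<dots> = int ((q * fact d) choose r) * int (\<gamma> r)"
          by (simp add: eq n_subsets[OF finY] Y(2))
        also have "\<dots> mod int q = 0"
          using dvd_choose_mult_fact[of r d q] r by (simp flip: dvd_eq_mod_eq_0)
        finally show ?thesis by (simp add: dvd_eq_mod_eq_0)
      qed
      ultimately show ?thesis by (simp only:) (rule dvd_sum)
    qed
    finally have "int q dvd (\<Sum>I\<in>F. s I * of_bool (I \<inter> Y \<noteq> {}))" .
    moreover have "Y \<noteq> {}" using Y(2) assms by auto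
    ultimately show "\<exists>y\<subseteq>{..<M}. y \<noteq> {} \<and>
        int q dvd (\<Sum>I | I \<subseteq> {..<M} \<and> card I \<le> d. s I * of_bool (I \<inter> y \<noteq> {}))"
      using Y(1) unfolding F_def by blast
  qed
qed

text \<open>The coordinates \<open>y\<close> enumerate the nonempty subsets of
  \<open>{..<M}\<close>, the indices \<open>i\<close> its subsets of at most \<open>n\<close>
  points, and \<open>e i y\<close> says that the two meet. At most \<open>n\<close> nonempty sets
  are all met by the set of their minima, which gives the second property.\<close>

lemma covering_family:
  fixes q n :: nat
  assumes "q > 0"
  obtains t R :: nat and e :: "nat \<Rightarrow> nat \<Rightarrow> bool"
  where "\<And>s :: nat \<Rightarrow> int. \<exists>y<t. int q dvd (\<Sum>i<R. s i * of_bool (e i y))"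
    and "\<And>J. \<lbrakk>J \<subseteq> {..<t}; card J \<le> n\<rbrakk> \<Longrightarrow> \<exists>i<R. \<forall>y\<in>J. e i y"
proof -
  from hitting_sum_divisible[OF assms, of n] obtain M where M: "\<forall>s :: nat set \<Rightarrow> int. \<exists>y\<subseteq>{..<M}. y \<noteq> {} \<and>
    int q dvd (\<Sum>I | I \<subseteq> {..<M} \<and> card I \<le> n. s I * of_bool (I \<inter> y \<noteq> {}))" ..
  define A where "A = {y. y \<subseteq> {..<M} \<and> y \<noteq> {}}"
  define F where "F = {I. I \<subseteq> {..<M} \<and> card I \<le> n}"
  have "finite A" "finite F" unfolding A_def F_def by (auto intro: finite_subset[of _ "Pow {..<M}"])
  then obtain hA hF where hA: "bij_betw hA {..<card A} A" and hF: "bij_betw hF {..<card F} F"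
    using ex_bij_betw_nat_finite[of A] ex_bij_betw_nat_finite[of F] by (auto simp: atLeast0LessThan)
  show thesis
  proof (rule that)
    fix s :: "nat \<Rightarrow> int"
    let ?s = "\<lambda>I. s (inv_into {..<card F} hF I)"
    from M[rule_format, of ?s] obtain y where y: "y \<in> A"
      "int q dvd (\<Sum>I\<in>F. ?s I * of_bool (I \<inter> y \<noteq> {}))" unfolding A_def F_def by auto
    obtain k where k: "k < card A" "y = hA k" using hA y(1) by (auto simp: bij_betw_def)
    have "(\<Sum>I\<in>F. ?s I * of_bool (I \<inter> y \<noteq> {})) =
        (\<Sum>i<card F. ?s (hF i) * of_bool (hF i \<inter> y \<noteq> {}))"
      by (rule sum.reindex_bij_betw[OF hF, symmetric])
    also have "\<dots> = (\<Sum>i<card F. s i * of_bool (hF i \<inter> hA k \<noteq> {}))"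
      using hF by (intro sum.cong refl) (simp add: bij_betw_def inv_into_f_f k(2))
    finally show "\<exists>y<card A. int q dvd (\<Sum>i<card F. s i * of_bool (hF i \<inter> hA y \<noteq> {}))"
      using y(2) k(1) by auto
  next
    fix J assume J: "J \<subseteq> {..<card A}" "card J \<le> n"
    define I where "I = (\<lambda>y. Min (hA y)) ` J"
    have Min: "Min (hA y) \<in> hA y" "hA y \<subseteq> {..<M}" if "y \<in> J" for y
    proof -
      have "hA y \<in> A" using hA J(1) that by (auto simp: bij_betw_def)
      then show "Min (hA y) \<in> hA y" "hA y \<subseteq> {..<M}"
        using finite_subset[of "hA y" "{..<M}"] by (auto simp: A_def)
    qed
    have "card I \<le> n" unfolding I_def
      using card_image_le[of J] J finite_subset[OF J(1)] by (meson finite_lessThan le_trans)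
    then have "I \<in> F" using Min by (auto simp: F_def I_def)
    then have "I \<in> hF ` {..<card F}" using hF by (simp add: bij_betw_def)
    then obtain i where "i < card F" "hF i = I" by auto
    then show "\<exists>i<card F. \<forall>y\<in>J. hF i \<inter> hA y \<noteq> {}"
      using Min(1) by (intro exI[of _ i]) (auto simp: I_def)
  qed
qed

section \<open>Commuting coordinates\<close>

text \<open>An ordered product, since the group need not be commutative; its recursion is that of
  \<open>word_value\<close> on a list of variables.\<close>

definition list_prod :: "('a, 'm) monoid_scheme \<Rightarrow> (nat \<Rightarrow> 'a) \<Rightarrow> nat list \<Rightarrow> 'a" where
  "list_prod G f js = foldr (\<lambda>j a. f j \<otimes>\<^bsub>G\<^esub> a) js \<one>\<^bsub>G\<^esub>"

lemma list_prod_simps [simp]: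
  "list_prod G f [] = \<one>\<^bsub>G\<^esub>" "list_prod G f (j # js) = f j \<otimes>\<^bsub>G\<^esub> list_prod G f js"
  by (simp_all add: list_prod_def)

context group
begin

lemma list_prod_closed: "(\<And>j. j \<in> set js \<Longrightarrow> f j \<in> carrier G) \<Longrightarrow> list_prod G f js \<in> carrier G"
  by (induction js) auto

lemma list_prod_in_subgroup:
  assumes "subgroup K G" "\<And>j. j \<in> set js \<Longrightarrow> f j \<in> K"
  shows "list_prod G f js \<in> K"
  using assms(2) by (induction js) (auto intro: subgroup.one_closed[OF assms(1)] subgroup.m_closed[OF assms(1)])

lemma subgroup_centralizer:
  assumes "S \<subseteq> carrier G"
  shows "subgroup (centralizer G S) G"
proof (rule subgroupI)
  show "inv g \<in> centralizer G S" if "g \<in> centralizer G S" for g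
  proof -
    have "inv g \<otimes> s = s \<otimes> inv g" if "s \<in> S" for s
    proof -
      have s: "s \<in> carrier G" "g \<in> carrier G" "g \<otimes> s = s \<otimes> g"
        using that \<open>g \<in> centralizer G S\<close> assms by (auto simp: centralizer_def)
      have "inv g \<otimes> s = inv g \<otimes> (s \<otimes> g) \<otimes> inv g" using s(1,2) by (simp add: m_assoc)
      also have "\<dots> = inv g \<otimes> (g \<otimes> s) \<otimes> inv g" by (simp only: s(3))
      also have "\<dots> = s \<otimes> inv g" using s(1,2) by (simp flip: m_assoc)
      finally show ?thesis .
    qed
    then show ?thesis using that by (simp add: centralizer_def)
  qed
  show "g \<otimes> h \<in> centralizer G S" if "g \<in> centralizer G S" "h \<in> centralizer G S" for g h
  proof -
    have "g \<otimes> h \<otimes> s = s \<otimes> (g \<otimes> h)" if "s \<in> S" for s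
    proof -
      have s: "s \<in> carrier G" "g \<in> carrier G" "h \<in> carrier G" "g \<otimes> s = s \<otimes> g" "h \<otimes> s = s \<otimes> h"
        using that \<open>g \<in> centralizer G S\<close> \<open>h \<in> centralizer G S\<close> assms by (auto simp: centralizer_def)
      have "g \<otimes> h \<otimes> s = g \<otimes> s \<otimes> h" using s(1-3) by (simp add: m_assoc s(5))
      also have "\<dots> = s \<otimes> (g \<otimes> h)" using s(1-3) by (simp add: m_assoc s(4))
      finally show ?thesis .
    qed
    then show ?thesis using that by (simp add: centralizer_def)
  qed
  show "centralizer G S \<noteq> {}" using assms by (auto simp: centralizer_def intro!: exI[of _ \<one>])
qed (auto simp: centralizer_def)

lemma generate_subset_centralizer:
  assumes "S \<subseteq> carrier G" "A \<subseteq> centralizer G S"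
  shows "generate G A \<subseteq> centralizer G S"
  using generate_subgroup_incl[OF assms(2) subgroup_centralizer[OF assms(1)]] .

text \<open>Commutation passes to generated subgroups one side at a time: the centraliser of
  \<open>B\<close> is a subgroup containing \<open>A\<close>, and then the centraliser of
  \<open>generate G A\<close> is one containing \<open>B\<close>.\<close>

lemma generate_commute:
  assumes "A \<subseteq> carrier G" "B \<subseteq> carrier G" "\<And>a b. a \<in> A \<Longrightarrow> b \<in> B \<Longrightarrow> a \<otimes> b = b \<otimes> a"
    and "x \<in> generate G A" "y \<in> generate G B"
  shows "x \<otimes> y = y \<otimes> x"
proof -
  have "generate G A \<subseteq> centralizer G B"
    using assms(1-3) by (intro generate_subset_centralizer) (auto simp: centralizer_def)
  then have "B \<subseteq> centralizer G (generate G A)" using assms(2) by (auto simp: centralizer_def)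
  then have "generate G B \<subseteq> centralizer G (generate G A)"
    using assms(1) by (intro generate_subset_centralizer generate_incl)
  then show ?thesis using assms(4,5) by (auto simp: centralizer_def)
qed

lemma center_eq_centralizer: "center G = centralizer G (carrier G)"
  by (simp add: center_def centralizer_def)

lemma subgroup_center: "subgroup (center G) G"
  unfolding center_eq_centralizer by (rule subgroup_centralizer) simp

text \<open>The elements commuting with \<open>g\<close> form a subgroup that contains the centre.
  For finite \<open>A\<close> this turns centrality into finitely many equations.\<close>

lemma in_centerI:
  assumes "generate G (center G \<union> A) = carrier G" "A \<subseteq> carrier G" "g \<in> carrier G"
    and "\<And>a. a \<in> A \<Longrightarrow> g \<otimes> a = a \<otimes> g"
  shows "g \<in> center G"
proof -
  have "generate G (center G \<union> A) \<subseteq> centralizer G {g}"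
    using assms(2-4) by (intro generate_subset_centralizer) (auto simp: centralizer_def center_def)
  then show ?thesis using assms(1,3) by (auto simp: centralizer_def center_def)
qed

lemma commute_list_prod:
  assumes "g \<in> carrier G" "\<And>j. j \<in> set js \<Longrightarrow> f j \<in> carrier G \<and> g \<otimes> f j = f j \<otimes> g"
  shows "g \<otimes> list_prod G f js = list_prod G f js \<otimes> g"
proof -
  have "list_prod G f js \<in> centralizer G {g}"
    using assms by (intro list_prod_in_subgroup subgroup_centralizer) (auto simp: centralizer_def)
  then show ?thesis by (simp add: centralizer_def)
qed

text \<open>The leading factor moves past the selected factors of other indices. This isolates from
  a product the coordinates of one incidence set, or a single coordinate.\<close>

lemma list_prod_filter:
  assumes "distinct js" "\<And>j. j \<in> set js \<Longrightarrow> f j \<in> carrier G"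
    and "\<And>i j. \<lbrakk>i \<in> set js; j \<in> set js; i \<noteq> j\<rbrakk> \<Longrightarrow> f i \<otimes> f j = f j \<otimes> f i"
  shows "list_prod G f js = list_prod G f (filter P js) \<otimes> list_prod G f (filter (\<lambda>j. \<not> P j) js)"
  using assms
proof (induction js)
  case (Cons j js)
  let ?A = "list_prod G f (filter P js)" and ?B = "list_prod G f (filter (\<lambda>j. \<not> P j) js)"
  have cl: "?A \<in> carrier G" "?B \<in> carrier G" "f j \<in> carrier G"
    using Cons.prems(2) by (auto intro!: list_prod_closed)
  have "f j \<otimes> ?A = ?A \<otimes> f j"
    using Cons.prems by (intro commute_list_prod) auto
  then have "f j \<otimes> ?A \<otimes> ?B = ?A \<otimes> (f j \<otimes> ?B)" using cl by (simp add: m_assoc)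
  moreover have "list_prod G f js = ?A \<otimes> ?B" using Cons by simp
  ultimately show ?case using cl by (simp add: m_assoc)
qed simp

text \<open>The clauses are proved together: for \<open>K i <#> P\<close> to be a subgroup,
  \<open>K i\<close> must commute with the product \<open>P\<close> of the remaining subgroups, and
  this comes from the third clause.\<close>

lemma commuting_subgroup_product:
  assumes "distinct is" "\<And>i. i \<in> set is \<Longrightarrow> subgroup (K i) G"
    and "\<forall>i\<in>set is. \<forall>j\<in>set is. i \<noteq> j \<longrightarrow> (\<forall>x\<in>K i. \<forall>y\<in>K j. x \<otimes> y = y \<otimes> x)"
  shows "subgroup (foldr (\<lambda>i A. K i <#> A) is {\<one>}) G \<and>
    (\<forall>i\<in>set is. K i \<subseteq> foldr (\<lambda>i A. K i <#> A) is {\<one>}) \<and>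
    (\<forall>g\<in>carrier G. (\<forall>i\<in>set is. \<forall>x\<in>K i. g \<otimes> x = x \<otimes> g) \<longrightarrow>
       (\<forall>y\<in>foldr (\<lambda>i A. K i <#> A) is {\<one>}. g \<otimes> y = y \<otimes> g))"
  using assms
proof (induction "is")
  case Nil
  then show ?case by (simp add: triv_subgroup)
next
  case (Cons i "is")
  define P where "P = foldr (\<lambda>i A. K i <#> A) is {\<one>}"
  have "subgroup P G \<and> (\<forall>i\<in>set is. K i \<subseteq> P) \<and>
    (\<forall>g\<in>carrier G. (\<forall>i\<in>set is. \<forall>x\<in>K i. g \<otimes> x = x \<otimes> g) \<longrightarrow> (\<forall>y\<in>P. g \<otimes> y = y \<otimes> g))"
    unfolding P_def by (rule Cons.IH) (use Cons.prems in simp_all)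
  note IH = this[THEN conjunct1] this[THEN conjunct2, THEN conjunct1, rule_format]
    this[THEN conjunct2, THEN conjunct2]
  have K: "subgroup (K i) G" using Cons.prems by simp
  note cl = subgroup.mem_carrier[OF K] subgroup.mem_carrier[OF IH(1)]
  have comm: "x \<otimes> y = y \<otimes> x" if "x \<in> K i" "y \<in> P" for x y
  proof -
    have "\<forall>j\<in>set is. \<forall>u\<in>K j. x \<otimes> u = u \<otimes> x" using Cons.prems(1,3) that(1) by auto
    then show ?thesis using IH(3) cl(1)[OF that(1)] that(2) by blast
  qed
  have in_KP: "x \<otimes> y \<in> K i <#> P" if "x \<in> K i" "y \<in> P" for x y
    using that by (auto simp: set_mult_def)
  have "subgroup (K i <#> P) G"
  proof (rule subgroupI)
    show "K i <#> P \<subseteq> carrier G" using cl by (auto simp: set_mult_def)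
    show "K i <#> P \<noteq> {}"
      using in_KP[OF subgroup.one_closed[OF K] subgroup.one_closed[OF IH(1)]] by blast
    show "inv z \<in> K i <#> P" if KP: "z \<in> K i <#> P" for z
    proof -
      obtain x y where z: "z = x \<otimes> y" "x \<in> K i" "y \<in> P" using KP by (auto simp: set_mult_def)
      have "inv z = inv x \<otimes> inv y" unfolding z(1) comm[OF z(2,3)] using z cl by (simp add: inv_mult_group)
      then show ?thesis using in_KP subgroup.m_inv_closed[OF K] subgroup.m_inv_closed[OF IH(1)] z by simp
    qed
    show "z \<otimes> z' \<in> K i <#> P" if KP: "z \<in> K i <#> P" "z' \<in> K i <#> P" for z z'
    proof -
      obtain x y x' y' where z: "z = x \<otimes> y" "x \<in> K i" "y \<in> P" "z' = x' \<otimes> y'" "x' \<in> K i" "y' \<in> P"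
        using KP by (auto simp: set_mult_def)
      have "z \<otimes> z' = x \<otimes> (y \<otimes> x') \<otimes> y'" using z cl by (simp add: m_assoc)
      also have "\<dots> = (x \<otimes> x') \<otimes> (y \<otimes> y')" using z cl by (simp add: m_assoc flip: comm)
      finally show ?thesis
        using in_KP subgroup.m_closed[OF K] subgroup.m_closed[OF IH(1)] z by simp
    qed
  qed
  moreover have "K i \<subseteq> K i <#> P"
  proof
    fix x assume "x \<in> K i"
    then show "x \<in> K i <#> P" using in_KP[OF _ subgroup.one_closed[OF IH(1)], of x] cl(1) by simp
  qed
  moreover have "P \<subseteq> K i <#> P"
  proof
    fix y assume "y \<in> P"
    then show "y \<in> K i <#> P" using in_KP[OF subgroup.one_closed[OF K], of y] cl(2) by simp
  qed
  then have "\<forall>j\<in>set is. K j \<subseteq> K i <#> P" using IH(2) by (meson subset_trans)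
  moreover
  have "g \<otimes> z = z \<otimes> g"
    if g: "g \<in> carrier G" "\<forall>i'\<in>set (i # is). \<forall>x\<in>K i'. g \<otimes> x = x \<otimes> g" and "z \<in> K i <#> P" for g z
  proof -
    obtain x y where z: "z = x \<otimes> y" "x \<in> K i" "y \<in> P" using \<open>z \<in> K i <#> P\<close> by (auto simp: set_mult_def)
    have xg: "g \<otimes> x = x \<otimes> g" and yg: "g \<otimes> y = y \<otimes> g" using z g IH(3) by auto
    have "g \<otimes> z = x \<otimes> (g \<otimes> y)" using z cl g(1) xg by (simp flip: m_assoc)
    also have "\<dots> = z \<otimes> g" unfolding yg using z cl g(1) by (simp add: m_assoc)
    finally show ?thesis .
  qed
  then have "\<forall>g\<in>carrier G. (\<forall>j\<in>set (i # is). \<forall>x\<in>K j. g \<otimes> x = x \<otimes> g) \<longrightarrow>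
      (\<forall>z\<in>K i <#> P. g \<otimes> z = z \<otimes> g)" by blast
  ultimately show ?case by (simp add: P_def[symmetric])
qed

end

section \<open>From commuting coordinates to a decomposition\<close>

context group
begin

text \<open>The \<open>t\<close> coordinates are sorted into \<open>n\<close> classes with one
  element of \<open>J\<close> in each, and \<open>K i\<close> is generated by the centre and the
  coordinates in class \<open>i\<close>. Different classes involve different coordinates, hence
  commute; the centre is included so that the product contains all generators.\<close>

lemma decomposition_of_commuting_coordinates:
  fixes x :: "nat \<Rightarrow> nat \<Rightarrow> 'a"
  assumes a: "\<And>s. s < \<sigma> \<Longrightarrow> a s \<in> carrier G" and x: "\<And>s j. \<lbrakk>s < \<sigma>; j < t\<rbrakk> \<Longrightarrow> x s j \<in> carrier G"
    and gen: "generate G (center G \<union> a ` {..<\<sigma>}) = carrier G"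
    and prod: "\<And>s. s < \<sigma> \<Longrightarrow> a s = list_prod G (x s) [0..<t]"
    and comm: "\<And>s s' i j. \<lbrakk>s < \<sigma>; s' < \<sigma>; i < t; j < t; i \<noteq> j\<rbrakk> \<Longrightarrow> x s i \<otimes> x s' j = x s' j \<otimes> x s i"
    and J: "J \<subseteq> {..<t}" "card J = n" "n \<ge> 1"
    and good: "\<And>j. j \<in> J \<Longrightarrow> \<exists>s<\<sigma>. x s j \<notin> centralizer G T"
  shows "\<exists>K :: nat \<Rightarrow> 'a set. (\<forall>i\<in>{1..n}. subgroup (K i) G) \<and>
    (\<forall>i\<in>{1..n}. \<forall>j\<in>{1..n}. i \<noteq> j \<longrightarrow> (\<forall>x\<in>K i. \<forall>y\<in>K j. x \<otimes> y = y \<otimes> x)) \<and>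
    carrier G = foldr (\<lambda>i A. K i <#> A) [1..<Suc n] {\<one>} \<and>
    (\<forall>i\<in>{1..n}. \<not> K i \<subseteq> centralizer G T)"
proof -
  have "finite J" using J(1) finite_subset by blast
  then obtain h where h: "bij_betw h {1..n} J" using J(2) ex_bij_betw_nat_finite_1 by blast
  \<comment> \<open>Coordinates outside \<open>J\<close> go to class 1, which exists because
    \<open>n \<ge> 1\<close>.\<close>
  define \<beta> where "\<beta> j = (if j \<in> J then inv_into {1..n} h j else 1)" for j
  have \<beta>: "\<beta> j \<in> {1..n}" for j
    using h J(3) inv_into_into[of j h "{1..n}"] by (auto simp: \<beta>_def bij_betw_def)
  have \<beta>h: "h i \<in> J \<and> \<beta> (h i) = i" if "i \<in> {1..n}" for i
    using h that by (auto simp: \<beta>_def bij_betw_def)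
  define U where "U i = {x s j |s j. s < \<sigma> \<and> j < t \<and> \<beta> j = i}" for i
  define K where "K i = generate G (center G \<union> U i)" for i
  have Uc: "center G \<union> U i \<subseteq> carrier G" for i using x by (auto simp: U_def center_def)
  have K: "subgroup (K i) G" for i unfolding K_def using generate_is_subgroup[OF Uc] .
  have KU: "center G \<union> U i \<subseteq> K i" for i unfolding K_def by (auto intro: generate.incl)
  have commK: "y \<otimes> z = z \<otimes> y" if "i \<noteq> j" "y \<in> K i" "z \<in> K j" for i j y z
  proof (rule generate_commute[OF Uc Uc _ that(2,3)[unfolded K_def]])
    fix u v assume uv: "u \<in> center G \<union> U i" "v \<in> center G \<union> U j"
    then have "u \<in> carrier G" "v \<in> carrier G" using Uc by auto
    with uv show "u \<otimes> v = v \<otimes> u"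
      using that(1) comm by (auto simp: center_def U_def)
  qed
  define P where "P = foldr (\<lambda>i A. K i <#> A) [1..<Suc n] {\<one>}"
  have P: "subgroup P G" "\<And>i. i \<in> {1..n} \<Longrightarrow> K i \<subseteq> P"
  proof -
    have "\<forall>i\<in>set [1..<Suc n]. \<forall>j\<in>set [1..<Suc n]. i \<noteq> j \<longrightarrow> (\<forall>x\<in>K i. \<forall>y\<in>K j. x \<otimes> y = y \<otimes> x)"
      using commK by blast
    from commuting_subgroup_product[OF distinct_upt K this]
    show "subgroup P G" "\<And>i. i \<in> {1..n} \<Longrightarrow> K i \<subseteq> P"
      unfolding P_def by (simp_all del: upt_Suc foldr_append add: K atLeastLessThanSuc_atLeastAtMost)
  qed
  have "a s \<in> P" if "s < \<sigma>" for s
    unfolding prod[OF that]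
  proof (rule list_prod_in_subgroup[OF P(1)])
    fix j assume "j \<in> set [0..<t]"
    then have "x s j \<in> U (\<beta> j)" using that by (auto simp: U_def)
    then show "x s j \<in> P" using KU P(2) \<beta> by blast
  qed
  moreover have "center G \<subseteq> P" using KU P(2)[of 1] J(3) by auto
  ultimately have "generate G (center G \<union> a ` {..<\<sigma>}) \<subseteq> P"
    by (intro generate_subgroup_incl P(1)) auto
  then have "carrier G = P" using gen subgroup.subset[OF P(1)] by simp
  moreover have "\<not> K i \<subseteq> centralizer G T" if i: "i \<in> {1..n}" for i
  proof -
    from \<beta>h[OF i] good obtain s where s: "s < \<sigma>" "x s (h i) \<notin> centralizer G T" by blast
    have "x s (h i) \<in> U i" using \<beta>h[OF i] J(1) s(1) by (auto simp: U_def)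
    then show ?thesis using KU s(2) by blast
  qed
  ultimately show ?thesis using K commK unfolding P_def by (intro exI[of _ K] conjI ballI impI) simp_all
qed

lemma many_noncentral_coordinates:
  fixes x :: "nat \<Rightarrow> nat \<Rightarrow> 'a" and e :: "nat \<Rightarrow> nat \<Rightarrow> bool"
  assumes a: "\<And>s. s < \<sigma> \<Longrightarrow> a s \<in> carrier G" and x: "\<And>s j. \<lbrakk>s < \<sigma>; j < t\<rbrakk> \<Longrightarrow> x s j \<in> carrier G"
    and gen: "generate G (center G \<union> a ` {..<\<sigma>}) = carrier G"
    and prod: "\<And>s. s < \<sigma> \<Longrightarrow> a s = list_prod G (x s) [0..<t]"
    and comm: "\<And>s s' i j. \<lbrakk>s < \<sigma>; s' < \<sigma>; i < t; j < t; i \<noteq> j\<rbrakk> \<Longrightarrow> x s i \<otimes> x s' j = x s' j \<otimes> x s i"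
    and \<sigma>: "0 < \<sigma>"
    and v: "\<And>i. i < R \<Longrightarrow> v i \<in> center G"
    and root: "\<And>i. i < R \<Longrightarrow> list_prod G (x 0) (filter (e i) [0..<t]) [^] q = v i [^] (q::nat)"
    and e: "\<And>J. \<lbrakk>J \<subseteq> {..<t}; card J \<le> n\<rbrakk> \<Longrightarrow> \<exists>i<R. \<forall>j\<in>J. e i j" and n: "n \<ge> 1"
    and nroot: "\<not> (\<exists>z\<in>center G. z [^] q = a 0 [^] q)"
  defines "T \<equiv> {h \<in> carrier G. h [^] q = \<one> \<and> group_commutator G h (a 0) = \<one>}"
  shows "\<exists>J\<subseteq>{..<t}. card J = n \<and> (\<forall>j\<in>J. \<exists>s<\<sigma>. x s j \<notin> centralizer G T)"
proof -
  define J where "J = {j. j < t \<and> (\<exists>s<\<sigma>. x s j \<notin> centralizer G T)}"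
  \<comment> \<open>\<open>u P\<close> is the part of the product \<open>a 0\<close> over the
    coordinates satisfying \<open>P\<close>; in the application \<open>a 0\<close> is
    \<open>b\<close>.\<close>
  define u where "u P = list_prod G (x 0) (filter P [0..<t])" for P
  have x0: "x 0 j \<in> carrier G" if "j < t" for j using x that \<sigma> by blast
  have u: "u P \<in> carrier G" for P using x0 by (auto simp: u_def intro!: list_prod_closed)
  have vc: "v i \<in> carrier G" if "i < R" for i using v[OF that] by (simp add: center_def)
  have vcomm: "v i \<otimes> g = g \<otimes> v i" if "i < R" "g \<in> carrier G" for i g
    using v[OF that(1)] that(2) by (simp add: center_def)
  have a0: "a 0 \<in> carrier G" using a \<sigma> by blast
  have split: "u P = u (\<lambda>j. P j \<and> Q j) \<otimes> u (\<lambda>j. P j \<and> \<not> Q j)" for P Q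
    using list_prod_filter[of "filter P [0..<t]" "x 0" Q] x0 comm[OF \<sigma> \<sigma>]
    by (simp add: u_def conj_commute)
  have a0u: "a 0 = u (\<lambda>_. True)" using prod[OF \<sigma>] by (simp add: u_def)
  have central: "x 0 j \<in> center G" if j: "j < t" "j \<notin> J" for j
  proof -
    obtain i where i: "i < R" "e i j" using e[of "{j}"] j n by auto
    \<comment> \<open>\<open>y\<close> lies in \<open>T\<close>, and only its factor \<open>x 0 j\<close> can fail to commute with the elements \<open>x s j\<close>.\<close>
    define y where "y = u (e i) \<otimes> inv (v i)"
    have iv: "inv (v i) \<in> center G" using subgroup.m_inv_closed[OF subgroup_center v[OF i(1)]] .
    have yc: "y \<in> carrier G" using u vc i by (simp add: y_def)
    have "y [^] q = u (e i) [^] q \<otimes> inv (v i) [^] q"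
      unfolding y_def using u vc[OF i(1)] iv by (intro pow_mult_distrib) (auto simp: center_def)
    also have "\<dots> = \<one>" using root[OF i(1)] u vc[OF i(1)] by (simp add: u_def nat_pow_inv)
    finally have yq: "y [^] q = \<one>" .
    \<comment> \<open>Distinct coordinates commute, so \<open>a 0\<close> commutes with each of its
      own factors, hence with \<open>u (e i)\<close> and with \<open>y\<close>.\<close>
    have "a 0 \<otimes> x 0 l = x 0 l \<otimes> a 0" if "l < t" for l
      unfolding prod[OF \<sigma>]
    proof (rule commute_list_prod[symmetric])
      fix j assume "j \<in> set [0..<t]"
      then show "x 0 j \<in> carrier G \<and> x 0 l \<otimes> x 0 j = x 0 j \<otimes> x 0 l"
        using comm[OF \<sigma> \<sigma> that, of j] x0 by (cases "j = l") auto
    qed (fact x0[OF that])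
    then have "a 0 \<otimes> u (e i) = u (e i) \<otimes> a 0"
      unfolding u_def using a0 x0 by (intro commute_list_prod) auto
    then have "u (e i) \<in> centralizer G {a 0}" using u by (simp add: centralizer_def)
    moreover have "inv (v i) \<in> centralizer G {a 0}" using iv a0 by (simp add: centralizer_def center_def)
    ultimately have "y \<in> centralizer G {a 0}"
      unfolding y_def using a0 by (intro subgroup.m_closed[OF subgroup_centralizer]) auto
    then have "group_commutator G y (a 0) = inv y \<otimes> inv (a 0) \<otimes> (a 0 \<otimes> y)"
      using yc a0 by (simp add: group_commutator_def centralizer_def m_assoc)
    then have "group_commutator G y (a 0) = \<one>" using yc a0 by (simp flip: inv_mult_group)
    then have yT: "y \<in> T" using yc yq by (simp add: T_def)
    have uj: "u (e i) = x 0 j \<otimes> u (\<lambda>l. e i l \<and> l \<noteq> j)"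
    proof -
      have "(\<lambda>l. e i l \<and> l = j) = (\<lambda>l. l = j)" using i(2) by auto
      moreover have "filter (\<lambda>l. l = j) [0..<t] = [j]" using j(1) by (induction t) (auto simp: less_Suc_eq)
      ultimately have "filter (\<lambda>l. e i l \<and> l = j) [0..<t] = [j]" by simp
      then have "u (\<lambda>l. e i l \<and> l = j) = x 0 j" using x0 j by (simp add: u_def)
      then show ?thesis using split[of "e i" "\<lambda>l. l = j"] by simp
    qed
    have xx: "x s j \<otimes> x 0 j = x 0 j \<otimes> x s j" if s: "s < \<sigma>" for s
    proof -
      \<comment> \<open>\<open>x 0 j\<close> is \<open>y \<otimes> v i \<otimes> inv w\<close>, and
        all three factors centralise \<open>x s j\<close>: \<open>y\<close> because
        \<open>j \<notin> J\<close>, \<open>v i\<close> because it is central, \<open>w\<close>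
        because its coordinates differ from \<open>j\<close>.\<close>
      define C where "C = centralizer G {x s j}"
      have C: "subgroup C G" unfolding C_def using x s j by (intro subgroup_centralizer) auto
      define w where "w = u (\<lambda>l. e i l \<and> l \<noteq> j)"
      have "x s j \<in> centralizer G T" using s j by (auto simp: J_def)
      then have "y \<in> C" using yT yc by (auto simp: C_def centralizer_def)
      have "x s j \<otimes> u (\<lambda>l. e i l \<and> l \<noteq> j) = u (\<lambda>l. e i l \<and> l \<noteq> j) \<otimes> x s j"
        unfolding u_def using x s j comm \<sigma> by (intro commute_list_prod) auto
      then have "w \<in> C" using u by (simp add: C_def w_def centralizer_def)
      moreover note \<open>y \<in> C\<close>
      moreover have "v i \<in> C" using vc[OF i(1)] vcomm[OF i(1)] x s j by (simp add: C_def centralizer_def)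
      moreover have "x 0 j = y \<otimes> v i \<otimes> inv w"
        using u vc[OF i(1)] x0[OF j(1)] by (simp add: y_def uj m_assoc w_def)
      ultimately have "x 0 j \<in> C"
        using subgroup.m_closed[OF C] subgroup.m_inv_closed[OF C] by simp
      then show ?thesis by (simp add: C_def centralizer_def)
    qed
    \<comment> \<open>Commutation with \<open>x s l\<close>, from \<open>xx\<close> for
      \<open>l = j\<close> and from \<open>comm\<close> otherwise, gives commutation with every
      \<open>a s\<close>, and these generate modulo the centre.\<close>
    show ?thesis
    proof (rule in_centerI[OF gen _ x0[OF j(1)]])
      show "a ` {..<\<sigma>} \<subseteq> carrier G" using a by auto
      fix g assume "g \<in> a ` {..<\<sigma>}"
      then obtain s where s: "s < \<sigma>" "g = a s" by auto
      have "x 0 j \<otimes> x s l = x s l \<otimes> x 0 j" if "l < t" for l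
        using xx[OF s(1)] comm[OF \<sigma> s(1) j(1) that] by (cases "l = j") auto
      then show "x 0 j \<otimes> g = g \<otimes> x 0 j"
        unfolding s(2) prod[OF s(1)] using x0[OF j(1)] x[OF s(1)] by (intro commute_list_prod) auto
    qed
  qed
  have "n \<le> card J"
  proof (rule ccontr)
    \<comment> \<open>Otherwise one \<open>e i\<close> contains \<open>J\<close>, the remaining
      factor \<open>z\<close> of \<open>a 0\<close> is central, and
      \<open>a 0 [^] q = (v i \<otimes> z) [^] q\<close> contradicts \<open>nroot\<close>.\<close>
    assume "\<not> n \<le> card J"
    then obtain i where i: "i < R" "\<forall>j\<in>J. e i j" using e[of J] by (auto simp: J_def)
    \<comment> \<open>The conjunct \<open>True\<close> keeps the term in the form produced by
      \<open>split\<close>.\<close>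
    define z where "z = u (\<lambda>j. True \<and> \<not> e i j)"
    have "z \<in> center G" unfolding z_def u_def
      by (rule list_prod_in_subgroup[OF subgroup_center]) (use i central in auto)
    have "a 0 = u (e i) \<otimes> z" using split[of "\<lambda>_. True" "e i"] a0u by (simp add: z_def)
    then have "a 0 [^] q = u (e i) [^] q \<otimes> z [^] q"
      using u \<open>z \<in> center G\<close> by (simp add: pow_mult_distrib center_def)
    also have "\<dots> = (v i \<otimes> z) [^] q"
      using root[OF i(1)] vcomm[OF i(1), of z] vc[OF i(1)] \<open>z \<in> center G\<close>
      by (simp add: u_def pow_mult_distrib center_def)
    finally show False
      using nroot v[OF i(1)] \<open>z \<in> center G\<close> subgroup.m_closed[OF subgroup_center] by metis
  qed
  then obtain J' where "J' \<subseteq> J" "card J' = n" by (rule obtain_subset_with_card_n)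
  moreover have "J \<subseteq> {..<t}" "\<forall>j\<in>J. \<exists>s<\<sigma>. x s j \<notin> centralizer G T" by (auto simp: J_def)
  ultimately show ?thesis by (intro exI[of _ J'] conjI) (simp_all add: subset_iff)
qed

end

section \<open>Values of words without coefficients\<close>

text \<open>Injectivity of \<open>\<phi>\<close> pulls the solution found in the image back to
  \<open>H\<close>, so systems can be written with coefficients and unknowns in \<open>H\<close>
  itself.\<close>

lemma strongly_verbally_closed_solve:
  assumes svc: "strongly_verbally_closed H" and G: "group G"
    and \<phi>: "\<phi> \<in> hom H G" "inj_on \<phi> (carrier H)" and vc: "verbally_closed (\<phi> ` carrier H) G"
    and W: "finite W" "W \<subseteq> eq_words (carrier H) r"
    and x: "x \<in> {..<r} \<rightarrow> carrier G" "\<And>w. w \<in> W \<Longrightarrow> word_value G x (map (map_letter \<phi>) w) = \<one>\<^bsub>G\<^esub>"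
  shows "\<exists>y \<in> {..<r} \<rightarrow> carrier H. \<forall>w\<in>W. word_value H y w = \<one>\<^bsub>H\<^esub>"
proof -
  have H: "group H" using svc by (simp add: strongly_verbally_closed_def)
  interpret group_hom H G \<phi>
    using H G \<phi>(1) by (simp add: group_hom_def group_hom_axioms_def)
  define W' where "W' = map (map_letter \<phi>) ` W"
  have "finite W'" "W' \<subseteq> eq_words (\<phi> ` carrier H) r"
    using W by (auto simp: W'_def intro!: eq_words_map)
  moreover have "\<exists>x \<in> {..<r} \<rightarrow> carrier G. \<forall>w\<in>W'. word_value G x w = \<one>\<^bsub>G\<^esub>"
    using x by (auto simp: W'_def)
  ultimately obtain z where z: "z \<in> {..<r} \<rightarrow> \<phi> ` carrier H" "\<forall>w\<in>W'. word_value G z w = \<one>\<^bsub>G\<^esub>"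
    using strongly_verbally_closedD[OF svc G \<phi> vc, unfolded algebraically_closed_def,
      THEN conjunct2, rule_format, of W' r] by auto
  define y where "y i = inv_into (carrier H) \<phi> (z i)" for i
  have y: "y \<in> {..<r} \<rightarrow> carrier H" "\<And>i. i < r \<Longrightarrow> \<phi> (y i) = z i"
    using z(1) by (auto simp: y_def Pi_iff inv_into_into f_inv_into_f)
  have "word_value H y w = \<one>\<^bsub>H\<^esub>" if w: "w \<in> W" for w
  proof -
    note V = word_value_hom[OF H G \<phi>(1) y(1), of w]
    have wH: "w \<in> eq_words (carrier H) r" using w W(2) by blast
    have "word_value G (\<lambda>i. \<phi> (y i)) (map (map_letter \<phi>) w) = word_value G z (map (map_letter \<phi>) w)"
      by (rule word_value_cong[OF eq_words_map[OF wH]]) (simp add: y(2))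
    also have "\<dots> = \<one>\<^bsub>G\<^esub>" using z(2) w by (simp add: W'_def)
    finally have "\<phi> (word_value H y w) = \<phi> \<one>\<^bsub>H\<^esub>" using V wH by simp
    then show ?thesis using V wH inj_onD[OF \<phi>(2)] by blast
  qed
  then show ?thesis using y(1) by blast
qed

text \<open>Over the integers a word without coefficients is the linear form given by its exponent
  sums.\<close>

lemma word_value_integer_group_linear:
  assumes "w \<in> eq_words {} r"
  shows "word_value integer_group (\<lambda>i. x i + k * y i) w =
    word_value integer_group x w + k * word_value integer_group y w"
  using assms unfolding eq_words_def by (induction w) (auto simp: algebra_simps)

text \<open>Division with remainder by the least positive element; the trivial subgroup is the case
  \<open>m = 0\<close>.\<close>

lemma int_subgroup_principal:
  fixes S :: "int set"
  assumes "0 \<in> S" "\<And>a b k. \<lbrakk>a \<in> S; b \<in> S\<rbrakk> \<Longrightarrow> a + k * b \<in> S"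
  shows "\<exists>m. S = {k. m dvd k}"
proof (cases "S = {0}")
  case True
  then show ?thesis by (intro exI[of _ 0]) auto
next
  case False
  define P where "P n \<longleftrightarrow> 0 < n \<and> int n \<in> S" for n
  obtain a where "a \<in> S" "a \<noteq> 0" using False assms(1) by auto
  then have "\<bar>a\<bar> \<in> S" using assms(2)[of 0 a "-1"] assms(1) by (cases "a \<ge> 0") auto
  then have "P (nat \<bar>a\<bar>)" using \<open>a \<noteq> 0\<close> by (simp add: P_def)
  then have m: "P (LEAST n. P n)" by (rule LeastI)
  define m where "m = (LEAST n. P n)"
  have m: "0 < m" "int m \<in> S" using m by (simp_all add: P_def m_def)
  have "int m dvd a" if "a \<in> S" for a
  proof (rule ccontr)
    assume "\<not> int m dvd a"
    then have pos: "0 < a mod int m" "a mod int m < int m"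
    proof -
      have "0 \<le> a mod int m" "a mod int m \<noteq> 0" using m(1) \<open>\<not> int m dvd a\<close> by (simp_all add: dvd_eq_mod_eq_0)
      then show "0 < a mod int m" by linarith
    qed (use m(1) in simp)
    have "a mod int m \<in> S"
      using assms(2)[OF that m(2), of "- (a div int m)"] by (simp add: minus_div_mult_eq_mod)
    then have "P (nat (a mod int m))" using pos by (simp add: P_def)
    then have "m \<le> nat (a mod int m)" unfolding m_def by (rule Least_le)
    then show False using pos by linarith
  qed
  moreover have "a \<in> S" if "int m dvd a" for a
    using that assms(2)[OF assms(1) m(2)] by (auto simp: dvd_def mult.commute)
  ultimately show ?thesis by (intro exI[of _ "int m"]) auto
qed

text \<open>Up to sign, \<open>m\<close> is the gcd of the exponent sums of \<open>w\<close>. Its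
  multiples are the exponents by which central twists of the arguments can shift a value of
  \<open>w\<close>.\<close>

lemma word_values_integer_group:
  assumes "w \<in> eq_words {} r"
  obtains m where "\<And>k. (\<exists>x. word_value integer_group x w = k) \<longleftrightarrow> m dvd k"
proof -
  let ?S = "range (\<lambda>x. word_value integer_group x w)"
  have "0 \<in> ?S"
    using word_value_integer_group_linear[OF assms, of "\<lambda>_. 0" "-1" "\<lambda>_. 0"] by (auto intro!: image_eqI)
  moreover have "a + k * b \<in> ?S" if "a \<in> ?S" "b \<in> ?S" for a b k
    using that by (auto simp flip: word_value_integer_group_linear[OF assms])
  ultimately have "\<exists>m. ?S = {k. m dvd k}" by (rule int_subgroup_principal)
  then obtain m where m: "?S = {k. m dvd k}" ..
  show thesis
  proof (rule that[of m])
    fix k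
    have "(\<exists>x. word_value integer_group x w = k) \<longleftrightarrow> k \<in> ?S" by auto
    then show "(\<exists>x. word_value integer_group x w = k) \<longleftrightarrow> m dvd k" unfolding m by simp
  qed
qed

lemma (in group) int_pow_center:
  assumes "c \<in> center G"
  shows "c [^] (k::int) \<in> center G"
  using subgroup_int_pow_closed[OF subgroup_center assms] .

text \<open>The central factors can be collected at the end of the word. Since \<open>w\<close> has
  no coefficients, \<open>f\<close> only adjusts the type of the letters and may be
  arbitrary.\<close>

lemma (in group) word_value_central_twist:
  assumes "w \<in> eq_words {} r" "x \<in> {..<r} \<rightarrow> carrier G" "c \<in> center G"
  shows "word_value G x w \<in> carrier G \<and>
    word_value G (\<lambda>i. x i \<otimes> c [^] (k i :: int)) w =
    word_value G x w \<otimes> c [^] word_value integer_group k (map (map_letter f) w)"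
  using assms(1) unfolding eq_words_def
proof (induction w)
  case Nil
  then show ?case by simp
next
  case (Cons l w)
  have c: "c \<in> carrier G" using assms(3) by (simp add: center_def)
  have comm: "c [^] j \<otimes> g = g \<otimes> c [^] j" if "g \<in> carrier G" for j :: int and g
    using int_pow_center[OF assms(3), of j] that by (simp add: center_def)
  define A where "A = word_value G x w"
  have IH: "A \<in> carrier G" "word_value G (\<lambda>i. x i \<otimes> c [^] k i) w =
      A \<otimes> c [^] word_value integer_group k (map (map_letter f) w)"
    using Cons.IH Cons.hyps unfolding A_def by auto
  have push: "(g \<otimes> c [^] j) \<otimes> (A \<otimes> c [^] j') = (g \<otimes> A) \<otimes> c [^] (j + j')" if "g \<in> carrier G" for g and j j' :: int
  proof -
    have "(g \<otimes> c [^] j) \<otimes> (A \<otimes> c [^] j') = g \<otimes> (c [^] j \<otimes> A) \<otimes> c [^] j'"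
      using that c IH(1) by (simp add: m_assoc)
    also have "\<dots> = (g \<otimes> A) \<otimes> c [^] (j + j')"
      unfolding comm[OF IH(1)] using that c IH(1) by (simp add: m_assoc int_pow_mult)
    finally show ?thesis .
  qed
  from Cons.hyps consider i where "i < r" "l = Var i" | i where "i < r" "l = VarInv i" by auto
  then show ?case
  proof cases
    case 1
    then have "x i \<in> carrier G" using assms(2) by auto
    then show ?thesis using 1 IH push by (simp add: A_def[symmetric])
  next
    case 2
    then have xi: "x i \<in> carrier G" using assms(2) by auto
    have "inv (x i \<otimes> c [^] k i) = inv (x i) \<otimes> c [^] (- k i)"
      using xi c comm[of "inv (x i)" "- k i"] by (simp add: inv_mult_group int_pow_neg)
    then show ?thesis using 2 xi IH push by (simp add: A_def[symmetric])
  qed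
qed

text \<open>Passes from the modulus \<open>q\<close> to the modulus \<open>m\<close> belonging to a
  word. Write \<open>m = m1 * g\<close> with \<open>g\<close> the gcd of \<open>m\<close> and
  \<open>q\<close>. Then \<open>m1\<close> divides every \<open>s i\<close>, and the hypothesis for
  the quotients \<open>s i div m1\<close> gives a sum divisible by \<open>m1 * q\<close>, a multiple
  of \<open>m\<close>.\<close>

lemma subfamily_sum_dvd:
  fixes m :: int and q :: nat
  assumes "q > 0" "\<And>i. i < R \<Longrightarrow> m dvd int q * s i"
    and "\<And>s :: nat \<Rightarrow> int. \<exists>y<t. int q dvd (\<Sum>i<R. s i * of_bool (e i y))"
  shows "\<exists>y<t. m dvd (\<Sum>i<R. s i * of_bool (e i y))"
proof -
  define g where "g = gcd m (int q)"
  have "g \<noteq> 0" using assms(1) by (simp add: g_def)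
  obtain m1 q1 where mq: "m = m1 * g" "int q = q1 * g" "coprime m1 q1"
    using gcd_coprime_exists[of m "int q"] \<open>g \<noteq> 0\<close> unfolding g_def by auto
  have "m1 dvd s i" if "i < R" for i
  proof -
    have "g * m1 dvd g * (q1 * s i)" using assms(2)[OF that] by (simp add: mq ac_simps)
    then have "m1 dvd q1 * s i" using \<open>g \<noteq> 0\<close> by (simp only: dvd_mult_cancel_left) simp
    then show ?thesis using mq(3) by (simp add: coprime_dvd_mult_right_iff)
  qed
  then have s: "s i = m1 * (s i div m1)" if "i < R" for i using that by simp
  obtain y where y: "y < t" "int q dvd (\<Sum>i<R. (s i div m1) * of_bool (e i y))"
    using assms(3)[of "\<lambda>i. s i div m1"] by auto
  have "m dvd m1 * int q" by (simp add: mq)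
  also have "m1 * int q dvd m1 * (\<Sum>i<R. (s i div m1) * of_bool (e i y))"
    using y(2) by (rule mult_dvd_mono[OF dvd_refl])
  also have "\<dots> = (\<Sum>i<R. s i * of_bool (e i y))"
    unfolding sum_distrib_left using s by (intro sum.cong refl) (simp flip: mult.assoc)
  finally show ?thesis using y(1) by blast
qed

section \<open>Adjoining central roots to a power of a group\<close>

text \<open>In the application \<open>c\<close> is \<open>b [^] q\<close>. Verbal closedness of the
  diagonal rests on \<open>cover\<close>, which also ensures \<open>t > 0\<close>.\<close>

locale root_adjunction = group H for H (structure) +
  fixes c :: 'a and q t R :: nat and e :: "nat \<Rightarrow> nat \<Rightarrow> bool"
  assumes c: "c \<in> center H" and q: "q > 0"
    and cover: "\<And>s :: nat \<Rightarrow> int. \<exists>y<t. int q dvd (\<Sum>i<R. s i * of_bool (e i y))"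
begin

definition D :: "((nat \<Rightarrow> 'a) \<times> (nat \<Rightarrow> int)) monoid" where
  "D = product_group {..<t} (\<lambda>_. H) \<times>\<times> product_group {..<R} (\<lambda>_. integer_group)"

text \<open>
  The second component of \<^term>\<open>D\<close> holds the exponents of the roots \<open>v\<^sub>i\<close>; the relators express
  that \<open>v\<^sub>i\<^sup>q\<close> has coordinate \<open>c\<close> where \<open>e i y\<close> holds and \<open>1\<close> elsewhere.
\<close>

definition relator :: "(nat \<Rightarrow> int) \<Rightarrow> (nat \<Rightarrow> 'a) \<times> (nat \<Rightarrow> int)" where
  "relator s = (\<lambda>y\<in>{..<t}. c [^] (- (\<Sum>i<R. s i * of_bool (e i y))), \<lambda>i\<in>{..<R}. int q * s i)"

definition N :: "((nat \<Rightarrow> 'a) \<times> (nat \<Rightarrow> int)) set" where "N = range relator"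

definition proj :: "(nat \<Rightarrow> 'a) \<times> (nat \<Rightarrow> int) \<Rightarrow> ((nat \<Rightarrow> 'a) \<times> (nat \<Rightarrow> int)) set" where
  "proj d = N #>\<^bsub>D\<^esub> d"

definition diag :: "'a \<Rightarrow> (nat \<Rightarrow> 'a) \<times> (nat \<Rightarrow> int)" where
  "diag h = (\<lambda>y\<in>{..<t}. h, \<lambda>i\<in>{..<R}. 0)"

definition incl :: "'a \<Rightarrow> ((nat \<Rightarrow> 'a) \<times> (nat \<Rightarrow> int)) set" where "incl h = proj (diag h)"

lemma c_closed: "c \<in> carrier H"
  using c by (simp add: center_def)

lemma c_pow_commute: "g \<in> carrier H \<Longrightarrow> c [^] (k::int) \<otimes> g = g \<otimes> c [^] k"
  using int_pow_center[OF c, of k] by (simp add: center_def)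

lemma group_D: "group D"
  unfolding D_def by (intro DirProd_group product_group group_axioms group_integer_group)

lemma carrier_D: "carrier D = (\<Pi>\<^sub>E y\<in>{..<t}. carrier H) \<times> (\<Pi>\<^sub>E i\<in>{..<R}. UNIV)"
  by (simp add: D_def)

lemma mult_D: "d \<otimes>\<^bsub>D\<^esub> d' = (\<lambda>y\<in>{..<t}. fst d y \<otimes> fst d' y, \<lambda>i\<in>{..<R}. snd d i + snd d' i)"
  by (simp add: D_def mult_DirProd')

lemma one_D: "\<one>\<^bsub>D\<^esub> = (\<lambda>y\<in>{..<t}. \<one>, \<lambda>i\<in>{..<R}. 0)"
  by (simp add: D_def)

lemma D_eqI:
  assumes "d \<in> carrier D" "d' \<in> carrier D" "\<And>y. y < t \<Longrightarrow> fst d y = fst d' y" "\<And>i. i < R \<Longrightarrow> snd d i = snd d' i"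
  shows "d = d'"
proof (rule prod_eqI)
  show "fst d = fst d'"
    using assms(1-3) by (intro PiE_ext[of _ "{..<t}" "\<lambda>_. carrier H"]) (auto simp: carrier_D)
  show "snd d = snd d'"
    using assms(1,2,4) by (intro PiE_ext[of _ "{..<R}" "\<lambda>_. UNIV"]) (auto simp: carrier_D)
qed

lemma fst_hom: "y < t \<Longrightarrow> (\<lambda>d. fst d y) \<in> hom D H"
  by (auto simp: hom_def carrier_D mult_D)

lemma snd_hom: "i < R \<Longrightarrow> (\<lambda>d. snd d i) \<in> hom D integer_group"
  by (auto simp: hom_def mult_D)

lemma diag_hom: "diag \<in> hom H D"
  by (auto simp: hom_def diag_def carrier_D mult_D fun_eq_iff)

lemma relator_closed: "relator s \<in> carrier D"
  using c_closed by (auto simp: relator_def carrier_D)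

lemma relator_mult: "relator s \<otimes>\<^bsub>D\<^esub> relator s' = relator (\<lambda>i. s i + s' i)"
proof -
  have "c [^] (- A) \<otimes> c [^] (- B) = c [^] (- (A + B))" for A B :: int
    using c_closed by (simp flip: int_pow_mult)
  then show ?thesis
    by (auto simp: relator_def mult_D fun_eq_iff sum.distrib distrib_right distrib_left)
qed

lemma relator_zero: "relator (\<lambda>_. 0) = \<one>\<^bsub>D\<^esub>"
  by (simp add: relator_def one_D)

lemma relator_commute:
  assumes "d \<in> carrier D"
  shows "relator s \<otimes>\<^bsub>D\<^esub> d = d \<otimes>\<^bsub>D\<^esub> relator s"
  using assms by (auto simp: relator_def mult_D carrier_D fun_eq_iff c_pow_commute PiE_iff)

lemma subgroup_N: "subgroup N D"
proof -
  interpret D: group D by (rule group_D)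
  show ?thesis
  proof (rule D.subgroupI)
    show "inv\<^bsub>D\<^esub> d \<in> N" if d: "d \<in> N" for d
    proof -
      obtain s where s: "d = relator s" using d by (auto simp: N_def)
      have "relator (\<lambda>i. - s i) \<otimes>\<^bsub>D\<^esub> relator s = \<one>\<^bsub>D\<^esub>"
        by (simp add: relator_mult relator_zero)
      then have "inv\<^bsub>D\<^esub> d = relator (\<lambda>i. - s i)"
        unfolding s by (rule D.inv_equality) (rule relator_closed)+
      then show ?thesis by (simp add: N_def)
    qed
  qed (auto simp: N_def relator_closed relator_mult)
qed

lemma normal_N: "N \<lhd> D"
proof -
  interpret D: group D by (rule group_D)
  have "x \<otimes>\<^bsub>D\<^esub> n \<otimes>\<^bsub>D\<^esub> inv\<^bsub>D\<^esub> x \<in> N" if x: "x \<in> carrier D" and n: "n \<in> N" for x n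
  proof -
    obtain s where s: "n = relator s" using n by (auto simp: N_def)
    have "x \<otimes>\<^bsub>D\<^esub> n \<otimes>\<^bsub>D\<^esub> inv\<^bsub>D\<^esub> x = n"
      unfolding s relator_commute[OF x, symmetric] using x by (simp add: D.m_assoc relator_closed)
    then show ?thesis using n by simp
  qed
  then show ?thesis unfolding D.normal_inv_iff using subgroup_N by blast
qed

lemma group_quotient: "group (D Mod N)"
  by (rule normal.factorgroup_is_group[OF normal_N])

lemma proj_hom: "proj \<in> hom D (D Mod N)"
  using normal.r_coset_hom_Mod[OF normal_N] unfolding proj_def[abs_def] .

lemma carrier_quotient: "carrier (D Mod N) = proj ` carrier D"
  by (simp add: carrier_FactGroup proj_def[abs_def])

lemma proj_relator: "proj (relator s) = \<one>\<^bsub>D Mod N\<^esub>"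
proof -
  interpret D: group D by (rule group_D)
  show ?thesis
    using D.coset_join2[OF relator_closed subgroup_N, of s] by (simp add: proj_def N_def)
qed

lemma proj_eqD:
  assumes "proj d = proj d'" "d \<in> carrier D"
  obtains s where "d = relator s \<otimes>\<^bsub>D\<^esub> d'"
proof -
  interpret D: group D by (rule group_D)
  have "d \<in> N #>\<^bsub>D\<^esub> d'"
    using D.rcos_self[OF assms(2) subgroup_N] assms(1) by (simp add: proj_def)
  then show thesis using that by (auto simp: r_coset_def N_def)
qed

lemma incl_hom: "incl \<in> hom H (D Mod N)"
  using diag_hom proj_hom by (auto simp: hom_def incl_def Pi_iff)

text \<open>Two diagonal elements with the same image differ by a relator; its integer part
  \<open>q * s i\<close> must vanish, so the relator is trivial.\<close>

lemma incl_inj: "inj_on incl (carrier H)"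
proof (rule inj_onI)
  fix g h assume gh: "g \<in> carrier H" "h \<in> carrier H" "incl g = incl h"
  have "diag g \<in> carrier D" using gh(1) diag_hom by (auto simp: hom_def)
  then obtain s where s: "diag g = relator s \<otimes>\<^bsub>D\<^esub> diag h"
    using proj_eqD gh(3) unfolding incl_def by metis
  have "s i = 0" if "i < R" for i
    using arg_cong[OF s, of "\<lambda>d. snd d i"] that q by (simp add: diag_def relator_def mult_D)
  then have zero: "(\<Sum>i<R. s i * of_bool (e i y)) = 0" for y by simp
  \<comment> \<open>\<open>cover\<close> supplies a coordinate in which to compare \<open>g\<close>
    and \<open>h\<close>.\<close>
  obtain y where "y < t" using cover[of "\<lambda>_. 0"] by auto
  then show "g = h"
    using arg_cong[OF s, of "\<lambda>d. fst d y"] gh(2) by (simp add: diag_def relator_def mult_D zero)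
qed

lemma map_letter_no_coefficients:
  "w \<in> eq_words {} r \<Longrightarrow> map (map_letter f) w = map (map_letter g) w"
  by (rule eq_words_map_cong) auto

text \<open>A solution is lifted to \<open>D\<close>, where the word takes the value
  \<open>relator s\<close> times \<open>diag h\<close>. The integer coordinates show each
  \<open>q * s i\<close> to be a value of the word on the integers, so
  \<open>subfamily_sum_dvd\<close> finds a coordinate whose error exponent is such a value
  too.\<close>

lemma incl_verbally_closed: "verbally_closed (incl ` carrier H) (D Mod N)"
  unfolding verbally_closed_def
proof (intro conjI allI ballI iffI)
  interpret \<phi>: group_hom H "D Mod N" incl
    using group_axioms group_quotient incl_hom by (simp add: group_hom_def group_hom_axioms_def)
  show "subgroup (incl ` carrier H) (D Mod N)" by (rule \<phi>.img_is_subgroup)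
  fix r and w :: "((nat \<Rightarrow> 'a) \<times> (nat \<Rightarrow> int)) set letter list" and g
  assume w: "w \<in> eq_words {} r" and g: "g \<in> incl ` carrier H"
  {
    assume "\<exists>x \<in> {..<r} \<rightarrow> incl ` carrier H. word_value (D Mod N) x w = g"
    moreover have "incl ` carrier H \<subseteq> carrier (D Mod N)" by auto
    ultimately show "\<exists>x \<in> {..<r} \<rightarrow> carrier (D Mod N). word_value (D Mod N) x w = g" by blast
  }
  assume "\<exists>x \<in> {..<r} \<rightarrow> carrier (D Mod N). word_value (D Mod N) x w = g"
  then obtain x where x: "x \<in> {..<r} \<rightarrow> carrier (D Mod N)" "word_value (D Mod N) x w = g" by auto
  obtain h where h: "h \<in> carrier H" "g = incl h" using g by auto
  define d where "d j = inv_into (carrier D) proj (x j)" for j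
  have d: "d \<in> {..<r} \<rightarrow> carrier D" and proj_d: "\<And>j. j < r \<Longrightarrow> proj (d j) = x j"
    using x(1) unfolding carrier_quotient by (auto simp: d_def Pi_iff inv_into_into f_inv_into_f)
  \<comment> \<open>Copies of \<open>w\<close> with the coefficient types of \<open>D\<close>,
    \<open>H\<close> and the integers; as \<open>w\<close> has no coefficients,
    \<open>undefined\<close> never occurs in them.\<close>
  define wD where "wD = map (map_letter (\<lambda>_. undefined :: (nat \<Rightarrow> 'a) \<times> (nat \<Rightarrow> int))) w"
  define wH where "wH = map (map_letter (\<lambda>_. undefined :: 'a)) w"
  define wZ where "wZ = map (map_letter (\<lambda>_. undefined :: int)) w"
  have words: "wD \<in> eq_words {} r" "wH \<in> eq_words {} r" "wZ \<in> eq_words {} r"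
    unfolding wD_def wH_def wZ_def using eq_words_map[OF w] by (metis image_empty)+
  have no_coef: "map (map_letter f) wD = map (map_letter f') w"
    "map (map_letter f1) wH = map (map_letter f1') w" for f f' f1 f1'
    using map_letter_no_coefficients[OF w] by (auto simp: wD_def wH_def letter.map_comp)
  have wid: "map (map_letter id) w = w" by (simp add: letter.map_id0)
  have wDc: "wD \<in> eq_words (carrier D) r" using words(1) eq_words_mono by blast
  have "proj (word_value D d wD) = word_value (D Mod N) (\<lambda>j. proj (d j)) w"
    using word_value_hom[OF group_D group_quotient proj_hom d wDc]
    by (simp add: no_coef(1)[of _ id] wid)
  also have "\<dots> = proj (diag h)"
    using word_value_cong[OF w, of "\<lambda>j. proj (d j)" x "D Mod N"] proj_d x(2) h(2) by (simp add: incl_def)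
  finally obtain s where s: "word_value D d wD = relator s \<otimes>\<^bsub>D\<^esub> diag h"
    using proj_eqD word_value_hom[OF group_D group_quotient proj_hom d wDc] by metis
  have sZ: "word_value integer_group (\<lambda>j. snd (d j) i) wZ = int q * s i" if i: "i < R" for i
  proof -
    have "map (map_letter (\<lambda>d. snd d i)) wD = wZ" unfolding wZ_def by (rule no_coef(1))
    then show ?thesis
      using word_value_hom[OF group_D group_integer_group snd_hom[OF i] d wDc] i
      by (simp add: s mult_D relator_def diag_def)
  qed
  obtain m where m: "\<And>k. (\<exists>x. word_value integer_group x wZ = k) \<longleftrightarrow> m dvd k"
    using word_values_integer_group[OF words(3)] by blast
  have "m dvd int q * s i" if "i < R" for i using sZ[OF that] m by blast
  then obtain y where y: "y < t" "m dvd (\<Sum>i<R. s i * of_bool (e i y))"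
    using subfamily_sum_dvd[of q R m s t e] q cover by blast
  then obtain k where k: "word_value integer_group k wZ = (\<Sum>i<R. s i * of_bool (e i y))"
    using m by blast
  \<comment> \<open>In coordinate \<open>y\<close> the error is a power of \<open>c\<close> whose exponent is a value of \<open>w\<close> on the integers,
    so it can be absorbed by multiplying the solution by powers of \<open>c\<close>.\<close>
  define z where "z j = fst (d j) y \<otimes> c [^] k j" for j
  have dy: "(\<lambda>j. fst (d j) y) \<in> {..<r} \<rightarrow> carrier H"
    using d fst_hom[OF y(1)] by (auto simp: hom_def Pi_iff)
  then have z: "z \<in> {..<r} \<rightarrow> carrier H" using c_closed by (auto simp: z_def Pi_iff)
  have "map (map_letter (\<lambda>d. fst d y)) wD = wH" unfolding wH_def by (rule no_coef(1))
  then have "word_value H (\<lambda>j. fst (d j) y) wH = c [^] (- (\<Sum>i<R. s i * of_bool (e i y))) \<otimes> h"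
    using word_value_hom[OF group_D group_axioms fst_hom[OF y(1)] d wDc] y(1)
    by (simp add: s mult_D relator_def diag_def)
  moreover have "map (map_letter (\<lambda>_. undefined)) wH = wZ" unfolding wZ_def by (rule no_coef(2))
  ultimately have "word_value H z wH =
      c [^] (- (\<Sum>i<R. s i * of_bool (e i y))) \<otimes> h \<otimes> c [^] (\<Sum>i<R. s i * of_bool (e i y))"
    using word_value_central_twist[OF words(2) dy c, of k "\<lambda>_. undefined"] by (simp add: z_def[abs_def] k)
  also have "\<dots> = h"
    using h(1) c_closed by (simp add: m_assoc flip: c_pow_commute) (simp add: int_pow_neg flip: m_assoc)
  finally have "word_value H z wH = h" .
  moreover have "wH \<in> eq_words (carrier H) r" using words(2) eq_words_mono by blast
  moreover have "map (map_letter incl) wH = w"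
    using no_coef(2)[of incl id] wid by simp
  ultimately have "word_value (D Mod N) (\<lambda>j. incl (z j)) w = g"
    using word_value_hom[OF group_axioms group_quotient incl_hom z, of wH] h(2) by simp
  moreover have "(\<lambda>j. incl (z j)) \<in> {..<r} \<rightarrow> incl ` carrier H" using z by auto
  ultimately show "\<exists>x \<in> {..<r} \<rightarrow> incl ` carrier H. word_value (D Mod N) x w = g" by blast
qed

end

section \<open>The words of the system of equations\<close>

lemma word_value_Vars: "word_value G x (map (\<lambda>j. Var (f j)) js) = list_prod G (\<lambda>j. x (f j)) js"
  by (induction js) simp_all

lemma (in group) word_value_power:
  assumes "x \<in> {..<r} \<rightarrow> carrier G" "w \<in> eq_words (carrier G) r"
  shows "word_value G x (concat (replicate n w)) = word_value G x w [^] n \<and>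
    concat (replicate n w) \<in> eq_words (carrier G) r"
proof (induction n)
  case 0
  show ?case by (simp add: eq_words_def)
next
  case (Suc n)
  have id: "id \<in> hom G G" by (simp add: hom_def)
  have "word_value G x w \<in> carrier G"
    using word_value_hom[OF group_axioms group_axioms id assms] by simp
  then have "word_value G x w \<otimes> word_value G x w [^] n = word_value G x w [^] Suc n"
    by (rule nat_pow_Suc2[symmetric])
  then show ?case
    using Suc word_value_append[OF group_axioms assms(1,2), of "concat (replicate n w)"] assms(2)
    by (simp add: eq_words_def)
qed

text \<open>\<open>a\<close> is instantiated with the inverse of the element to be factored, so that
  the equation sets this element equal to the product of \<open>t\<close> consecutive
  unknowns.\<close>

definition product_word :: "nat \<Rightarrow> nat \<Rightarrow> 'a \<Rightarrow> 'a letter list" where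
  "product_word k t a = Coef a # map (\<lambda>j. Var (k + j)) [0..<t]"

definition commutator_word :: "nat \<Rightarrow> nat \<Rightarrow> 'a letter list" where
  "commutator_word i j = [VarInv i, VarInv j, Var i, Var j]"

definition root_word :: "nat \<Rightarrow> nat \<Rightarrow> nat list \<Rightarrow> 'a letter list" where
  "root_word q i js = concat (replicate q [VarInv i]) @ concat (replicate q (map Var js))"

text \<open>With \<open>b\<close> the inverse of \<open>a\<close> this is the commutator of the
  unknown and \<open>a\<close>. The inverse is a separate argument, so that every map of the
  coefficients keeps the form of the word.\<close>

definition centralizing_word :: "nat \<Rightarrow> 'a \<Rightarrow> 'a \<Rightarrow> 'a letter list" where
  "centralizing_word i a b = [VarInv i, Coef b, Var i, Coef a]"

lemma system_words_map:
  "map (map_letter f) (product_word k t a) = product_word k t (f a)"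
  "map (map_letter f) (commutator_word i j) = commutator_word i j"
  "map (map_letter f) (root_word q i js) = root_word q i js"
  "map (map_letter f) (centralizing_word i a b) = centralizing_word i (f a) (f b)"
  by (simp_all add: product_word_def commutator_word_def root_word_def centralizing_word_def map_concat o_def)

lemma system_words_in_eq_words:
  "\<lbrakk>a \<in> A; k + t \<le> r\<rbrakk> \<Longrightarrow> product_word k t a \<in> eq_words A r"
  "\<lbrakk>i < r; j < r\<rbrakk> \<Longrightarrow> commutator_word i j \<in> eq_words A r"
  "\<lbrakk>i < r; set js \<subseteq> {..<r}\<rbrakk> \<Longrightarrow> root_word q i js \<in> eq_words A r"
  "\<lbrakk>i < r; a \<in> A; b \<in> A\<rbrakk> \<Longrightarrow> centralizing_word i a b \<in> eq_words A r"
  unfolding product_word_def commutator_word_def root_word_def centralizing_word_def eq_words_def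
  by (auto split: if_splits simp: subset_iff)

context group
begin

lemma inv_mult_eq_one_iff:
  assumes "a \<in> carrier G" "b \<in> carrier G"
  shows "inv a \<otimes> b = \<one> \<longleftrightarrow> a = b"
proof
  assume "inv a \<otimes> b = \<one>"
  then have "a \<otimes> (inv a \<otimes> b) = a" using assms by simp
  then show "a = b" using assms by (simp flip: m_assoc)
qed (use assms in simp)

lemma product_word_value:
  assumes "a \<in> carrier G" "\<And>j. j < t \<Longrightarrow> x (k + j) \<in> carrier G"
  shows "word_value G x (product_word k t (inv a)) = \<one> \<longleftrightarrow> a = list_prod G (\<lambda>j. x (k + j)) [0..<t]"
proof -
  have "list_prod G (\<lambda>j. x (k + j)) [0..<t] \<in> carrier G" using assms(2) by (intro list_prod_closed) auto
  then show ?thesis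
    using assms(1) by (simp add: product_word_def word_value_Vars inv_mult_eq_one_iff)
qed

lemma commutator_word_value:
  assumes "x i \<in> carrier G" "x j \<in> carrier G"
  shows "word_value G x (commutator_word i j) = \<one> \<longleftrightarrow> x i \<otimes> x j = x j \<otimes> x i"
proof -
  have "word_value G x (commutator_word i j) = inv (x j \<otimes> x i) \<otimes> (x i \<otimes> x j)"
    using assms by (simp add: commutator_word_def inv_mult_group m_assoc)
  then show ?thesis using assms inv_mult_eq_one_iff[of "x j \<otimes> x i" "x i \<otimes> x j"] by auto
qed

lemma centralizing_word_value:
  assumes "x i \<in> carrier G" "a \<in> carrier G"
  shows "word_value G x (centralizing_word i a (inv a)) = \<one> \<longleftrightarrow> x i \<otimes> a = a \<otimes> x i"
proof -
  have "word_value G x (centralizing_word i a (inv a)) = inv (a \<otimes> x i) \<otimes> (x i \<otimes> a)"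
    using assms by (simp add: centralizing_word_def inv_mult_group m_assoc)
  then show ?thesis using assms inv_mult_eq_one_iff[of "a \<otimes> x i" "x i \<otimes> a"] by auto
qed

lemma root_word_value:
  assumes "i < r" "set js \<subseteq> {..<r}" "x \<in> {..<r} \<rightarrow> carrier G"
  shows "word_value G x (root_word q i js) = inv (x i [^] q) \<otimes> list_prod G x js [^] q"
proof -
  have w: "[VarInv i] \<in> eq_words (carrier G) r" "map Var js \<in> eq_words (carrier G) r"
    using assms(1,2) by (auto simp: eq_words_def lists_eq_set)
  have xi: "x i \<in> carrier G" using assms(1,3) by auto
  have "word_value G x (root_word q i js) = word_value G x [VarInv i] [^] q \<otimes> word_value G x (map Var js) [^] q"
    unfolding root_word_def using word_value_power[OF assms(3) w(1), of q] word_value_power[OF assms(3) w(2), of q]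
    by (simp add: word_value_append[OF group_axioms assms(3)])
  then show ?thesis using xi word_value_Vars[of G x "\<lambda>j. j" js] by (simp add: nat_pow_inv)
qed

lemma list_prod_single:
  assumes "distinct js" "a \<in> carrier G"
  shows "list_prod G (\<lambda>j. if j = y then a else \<one>) js = (if y \<in> set js then a else \<one>)"
  using assms by (induction js) auto

end

section \<open>Solving the system in the enlarged group and transferring it to
  \<open>H\<close>\<close>

context root_adjunction
begin

text \<open>It suffices that the value in \<open>D\<close> is \<open>relator s\<close>, which is
  checked coordinatewise: a diagonal coefficient is itself in each coordinate from \<open>H\<close>
  and 0 in each integer coordinate.\<close>

lemma quotient_word_value_one:
  assumes w: "w \<in> eq_words (carrier H) r" and x: "x \<in> {..<r} \<rightarrow> carrier D"
    and H: "\<And>y. y < t \<Longrightarrow> word_value H (\<lambda>\<alpha>. fst (x \<alpha>) y) w = c [^] (- (\<Sum>i<R. s i * of_bool (e i y)))"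
    and Z: "\<And>i. i < R \<Longrightarrow> word_value integer_group (\<lambda>\<alpha>. snd (x \<alpha>) i) (map (map_letter (\<lambda>_. 0)) w) = int q * s i"
  shows "word_value (D Mod N) (\<lambda>\<alpha>. proj (x \<alpha>)) (map (map_letter incl) w) = \<one>\<^bsub>D Mod N\<^esub>"
proof -
  define wD where "wD = map (map_letter diag) w"
  have "diag ` carrier H \<subseteq> carrier D" using diag_hom by (auto simp: hom_def)
  then have wD: "wD \<in> eq_words (carrier D) r"
    unfolding wD_def using eq_words_map[OF w, of diag] eq_words_mono by blast
  have "word_value D x wD = relator s"
  proof (rule D_eqI)
    show "word_value D x wD \<in> carrier D"
      using word_value_hom[OF group_D group_quotient proj_hom x wD] by simp
    show "relator s \<in> carrier D" by (rule relator_closed)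
    show "fst (word_value D x wD) y = fst (relator s) y" if y: "y < t" for y
    proof -
      have "map (map_letter (\<lambda>d. fst d y)) wD = map (map_letter id) w"
        unfolding wD_def by (simp add: letter.map_comp o_def diag_def y id_def)
      then show ?thesis
        using word_value_hom[OF group_D group_axioms fst_hom[OF y] x wD] H[OF y] y
        by (simp add: letter.map_id0 relator_def)
    qed
    show "snd (word_value D x wD) i = snd (relator s) i" if i: "i < R" for i
    proof -
      have "map (map_letter (\<lambda>d. snd d i)) wD = map (map_letter (\<lambda>_. 0)) w"
        unfolding wD_def by (simp add: letter.map_comp o_def diag_def i)
      then show ?thesis
        using word_value_hom[OF group_D group_integer_group snd_hom[OF i] x wD] Z[OF i] i
        by (simp add: relator_def)
    qed
  qed
  moreover have "map (map_letter proj) wD = map (map_letter incl) w"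
    unfolding wD_def by (simp add: letter.map_comp o_def incl_def[abs_def])
  ultimately show ?thesis
    using word_value_hom[OF group_D group_quotient proj_hom x wD] by (simp add: proj_relator)
qed

end

lemma list_prod_cong: "(\<And>j. j \<in> set js \<Longrightarrow> f j = g j) \<Longrightarrow> list_prod G f js = list_prod G g js"
  by (induction js) auto

lemma list_prod_zero: "(\<And>j. j \<in> set js \<Longrightarrow> f j = 0) \<Longrightarrow> list_prod integer_group f js = 0"
  by (induction js) auto

context root_adjunction
begin

text \<open>The conclusions form a finite system over \<open>H\<close>, solved in
  \<open>D Mod N\<close> by the coordinates of the diagonal elements \<open>a s\<close> and the
  adjoined roots. Centrality of the roots is recorded as commutation with the finitely many
  \<open>a s\<close>.\<close>

lemma commuting_coordinates_system:
  fixes \<sigma> :: nat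
  assumes svc: "strongly_verbally_closed H" and \<sigma>: "0 < \<sigma>"
    and a: "\<And>s. s < \<sigma> \<Longrightarrow> a s \<in> carrier H" and root: "c = a 0 [^] q"
  obtains x v where "\<And>s j. \<lbrakk>s < \<sigma>; j < t\<rbrakk> \<Longrightarrow> x s j \<in> carrier H" "\<And>i. i < R \<Longrightarrow> v i \<in> carrier H"
    "\<And>s. s < \<sigma> \<Longrightarrow> a s = list_prod H (x s) [0..<t]"
    "\<And>s s' i j. \<lbrakk>s < \<sigma>; s' < \<sigma>; i < t; j < t; i \<noteq> j\<rbrakk> \<Longrightarrow> x s i \<otimes> x s' j = x s' j \<otimes> x s i"
    "\<And>i. i < R \<Longrightarrow> list_prod H (x 0) (filter (e i) [0..<t]) [^] q = v i [^] q"
    "\<And>i s. \<lbrakk>i < R; s < \<sigma>\<rbrakk> \<Longrightarrow> v i \<otimes> a s = a s \<otimes> v i"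
proof -
  \<comment> \<open>Variable \<open>s * t + j\<close> stands for \<open>x s j\<close> and variable \<open>\<sigma> * t + i\<close> for \<open>v i\<close>.\<close>
  define r where "r = \<sigma> * t + R"
  have index: "s * t + j < \<sigma> * t" if "s < \<sigma>" "j < t" for s j
  proof -
    have "s * t + j < Suc s * t" using that by simp
    also have "\<dots> \<le> \<sigma> * t" using that by (intro mult_le_mono1) simp
    finally show ?thesis .
  qed
  then have index': "s * t + j < r" if "s < \<sigma>" "j < t" for s j using that by (force simp: r_def)
  have index0: "j < \<sigma> * t" "j < r" if "j < t" for j using index[OF \<sigma> that] index'[OF \<sigma> that] by simp_all
  have row: "s * t + t \<le> r" if "s < \<sigma>" for s
    using mult_le_mono1[of "Suc s" \<sigma> t] that by (simp add: r_def)
  let ?js = "\<lambda>i. filter (e i) [0..<t]"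
  define W1 where "W1 = (\<lambda>s. product_word (s * t) t (inv (a s))) ` {..<\<sigma>}"
  define W2 :: "'a letter list set" where "W2 = (\<lambda>(s, s', i, j). commutator_word (s * t + i) (s' * t + j)) `
    {(s, s', i, j). s < \<sigma> \<and> s' < \<sigma> \<and> i < t \<and> j < t \<and> i \<noteq> j}"
  \<comment> \<open>Row 0 occupies the variables below \<open>t\<close>, so the indices in
    \<open>?js i\<close> are themselves the variables for \<open>x 0 j\<close>.\<close>
  define W3 :: "'a letter list set" where "W3 = (\<lambda>i. root_word q (\<sigma> * t + i) (?js i)) ` {..<R}"
  define W4 where "W4 = (\<lambda>(i, s). centralizing_word (\<sigma> * t + i) (a s) (inv (a s))) ` ({..<R} \<times> {..<\<sigma>})"
  define W where "W = W1 \<union> W2 \<union> W3 \<union> W4"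
  have "{(s, s', i, j). s < \<sigma> \<and> s' < \<sigma> \<and> i < t \<and> j < t \<and> i \<noteq> j} \<subseteq> {..<\<sigma>} \<times> {..<\<sigma>} \<times> {..<t} \<times> {..<t}"
    by auto
  then have "finite {(s, s', i, j). s < \<sigma> \<and> s' < \<sigma> \<and> i < t \<and> j < t \<and> i \<noteq> j}"
    by (rule finite_subset) simp
  then have finW: "finite W"
    unfolding W_def W1_def W2_def W3_def W4_def
    by (intro finite_UnI finite_imageI finite_cartesian_product finite_lessThan)
  have "W1 \<subseteq> eq_words (carrier H) r"
    using a row by (auto simp: W1_def intro!: system_words_in_eq_words)
  moreover have "W2 \<subseteq> eq_words (carrier H) r"
    using index' by (auto simp: W2_def intro!: system_words_in_eq_words)
  moreover have "W3 \<subseteq> eq_words (carrier H) r"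
    using index0 by (auto simp: W3_def r_def intro!: system_words_in_eq_words)
  moreover have "W4 \<subseteq> eq_words (carrier H) r"
    using a by (auto simp: W4_def r_def intro!: system_words_in_eq_words)
  ultimately have W: "W \<subseteq> eq_words (carrier H) r" by (simp add: W_def)
  \<comment> \<open>The solution in \<open>D\<close>: the unknown for \<open>x s j\<close> has
    \<open>a s\<close> in coordinate \<open>j\<close> and is trivial elsewhere, the unknown for
    \<open>v i\<close> is the \<open>i\<close>-th unit vector of exponents.\<close>
  define x where "x \<alpha> = (if \<alpha> < \<sigma> * t
      then (\<lambda>y\<in>{..<t}. if \<alpha> mod t = y then a (\<alpha> div t) else \<one>, \<lambda>i\<in>{..<R}. 0)
      else (\<lambda>y\<in>{..<t}. \<one>, \<lambda>i\<in>{..<R}. of_bool (\<alpha> = \<sigma> * t + i) :: int))" for \<alpha>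
  have x: "x \<in> {..<r} \<rightarrow> carrier D"
    using a by (auto simp: x_def carrier_D less_mult_imp_div_less)
  have xH: "(\<lambda>\<alpha>. fst (x \<alpha>) y) \<in> {..<r} \<rightarrow> carrier H" if "y < t" for y
    using x fst_hom[OF that] by (auto simp: hom_def Pi_iff)
  have x_row_fst: "fst (x (s * t + j)) y = (if j = y then a s else \<one>)"
    if "s < \<sigma>" "j < t" "y < t" for s j y
    using that index[OF that(1,2)] by (simp add: x_def)
  have x_row_snd: "snd (x (s * t + j)) i = 0" if "s < \<sigma>" "j < t" "i < R" for s j i
    using that index[OF that(1,2)] by (simp add: x_def)
  have x_root_fst: "fst (x (\<sigma> * t + i)) y = \<one>" if "y < t" for i y
    using that by (simp add: x_def)
  \<comment> \<open>The equations other than the root equations already hold in \<open>D\<close>,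
    which is the case of the zero relator.\<close>
  have trivial: "word_value (D Mod N) (\<lambda>\<alpha>. proj (x \<alpha>)) (map (map_letter incl) w) = \<one>\<^bsub>D Mod N\<^esub>"
    if "w \<in> W" "\<And>y. y < t \<Longrightarrow> word_value H (\<lambda>\<alpha>. fst (x \<alpha>) y) w = \<one>"
      "\<And>i. i < R \<Longrightarrow> word_value integer_group (\<lambda>\<alpha>. snd (x \<alpha>) i) (map (map_letter (\<lambda>_. 0)) w) = 0" for w
    using quotient_word_value_one[of w r x "\<lambda>_. 0"] that W x by auto
  have solved: "word_value (D Mod N) (\<lambda>\<alpha>. proj (x \<alpha>)) (map (map_letter incl) w) = \<one>\<^bsub>D Mod N\<^esub>"
    if w: "w \<in> W" for w
  proof -
    from w consider "w \<in> W1" | "w \<in> W2" | "w \<in> W3" | "w \<in> W4" by (auto simp: W_def)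
    then show ?thesis
    proof cases
      case 1
      then obtain s where s: "s < \<sigma>" "w = product_word (s * t) t (inv (a s))" by (auto simp: W1_def)
      show ?thesis
      proof (rule trivial[OF w])
        fix y assume y: "y < t"
        have "list_prod H (\<lambda>j. fst (x (s * t + j)) y) [0..<t] = list_prod H (\<lambda>j. if j = y then a s else \<one>) [0..<t]"
          using x_row_fst s(1) y by (intro list_prod_cong) auto
        also have "\<dots> = a s" using list_prod_single[of "[0..<t]" "a s" y] a[OF s(1)] y by simp
        finally have "list_prod H (\<lambda>j. fst (x (s * t + j)) y) [0..<t] = a s" .
        then show "word_value H (\<lambda>\<alpha>. fst (x \<alpha>) y) w = \<one>"
          unfolding s(2) using a[OF s(1)] index'[OF s(1)] xH[OF y]
          by (subst product_word_value) (auto simp: Pi_iff)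
      next
        fix i assume "i < R"
        then have "list_prod integer_group (\<lambda>j. snd (x (s * t + j)) i) [0..<t] = 0"
          using x_row_snd[OF s(1)] by (intro list_prod_zero) auto
        then show "word_value integer_group (\<lambda>\<alpha>. snd (x \<alpha>) i) (map (map_letter (\<lambda>_. 0)) w) = 0"
          unfolding s(2) system_words_map by (simp add: product_word_def word_value_Vars)
      qed
    next
      case 2
      then obtain s s' i j where s: "s < \<sigma>" "s' < \<sigma>" "i < t" "j < t" "i \<noteq> j"
        "w = commutator_word (s * t + i) (s' * t + j)" by (auto simp: W2_def)
      show ?thesis
      proof (rule trivial[OF w])
        fix y assume y: "y < t"
        show "word_value H (\<lambda>\<alpha>. fst (x \<alpha>) y) w = \<one>"
          unfolding s(6) using s(1-5) y a
          by (subst commutator_word_value) (auto simp: x_row_fst)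
      next
        fix l assume "l < R"
        then show "word_value integer_group (\<lambda>\<alpha>. snd (x \<alpha>) l) (map (map_letter (\<lambda>_. 0)) w) = 0"
          unfolding s(6) system_words_map by (simp add: commutator_word_def)
      qed
    next
      case 3
      then obtain i where i: "i < R" "w = root_word q (\<sigma> * t + i) (?js i)" by (auto simp: W3_def)
      have ir: "\<sigma> * t + i < r" "set (?js i) \<subseteq> {..<r}" using i(1) index0 by (auto simp: r_def)
      show ?thesis
      \<comment> \<open>The root word contains the \<open>i\<close>-th root with exponent
        \<open>-q\<close> and yields \<open>c\<close> where \<open>e i y\<close> holds, so its value
        is the relator of minus the \<open>i\<close>-th unit vector.\<close>
      proof (rule quotient_word_value_one[where s = "\<lambda>i'. - of_bool (i' = i)"])
        show "w \<in> eq_words (carrier H) r" using w W by blast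
        fix y assume y: "y < t"
        have "list_prod H (\<lambda>\<alpha>. fst (x \<alpha>) y) (?js i) = list_prod H (\<lambda>j. if j = y then a 0 else \<one>) (?js i)"
          using x_row_fst[OF \<sigma> _ y] by (intro list_prod_cong) auto
        also have "\<dots> = (if e i y then a 0 else \<one>)"
          using list_prod_single[of "?js i" "a 0" y] a[OF \<sigma>] y by simp
        finally have "word_value H (\<lambda>\<alpha>. fst (x \<alpha>) y) w = (if e i y then c else \<one>)"
          unfolding i(2) using root_word_value[OF ir xH[OF y], of q] a[OF \<sigma>]
          by (simp add: x_root_fst[OF y] root)
        moreover have "(\<Sum>i'<R. - of_bool (i' = i) * of_bool (e i' y)) = (- of_bool (e i y) :: int)"
        proof -
          have "(\<Sum>i'<R. - of_bool (i' = i) * of_bool (e i' y)) = (\<Sum>i'<R. if i' = i then - of_bool (e i y) else (0::int))"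
            by (intro sum.cong) auto
          then show ?thesis using i(1) by simp
        qed
        ultimately show "word_value H (\<lambda>\<alpha>. fst (x \<alpha>) y) w =
            c [^] (- (\<Sum>i'<R. - of_bool (i' = i) * of_bool (e i' y)) :: int)"
          using c_closed by simp
      next
        fix l assume l: "l < R"
        have "list_prod integer_group (\<lambda>\<alpha>. snd (x \<alpha>) l) (?js i) = 0"
          using x_row_snd[OF \<sigma> _ l] by (intro list_prod_zero) auto
        moreover have "snd (x (\<sigma> * t + i)) l = of_bool (l = i)" using l by (auto simp: x_def)
        ultimately show "word_value integer_group (\<lambda>\<alpha>. snd (x \<alpha>) l) (map (map_letter (\<lambda>_. 0)) w) =
            int q * - of_bool (l = i)"
          unfolding i(2) system_words_map
          using group.root_word_value[OF group_integer_group ir, of "\<lambda>\<alpha>. snd (x \<alpha>) l" q] by simp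
      qed (rule x)
    next
      case 4
      then obtain i s where i: "i < R" "s < \<sigma>" "w = centralizing_word (\<sigma> * t + i) (a s) (inv (a s))"
        by (auto simp: W4_def)
      show ?thesis
      proof (rule trivial[OF w])
        fix y assume y: "y < t"
        show "word_value H (\<lambda>\<alpha>. fst (x \<alpha>) y) w = \<one>"
          unfolding i(3) using a[OF i(2)]
          by (subst centralizing_word_value) (auto simp: x_root_fst[OF y])
      next
        fix l assume "l < R"
        then show "word_value integer_group (\<lambda>\<alpha>. snd (x \<alpha>) l) (map (map_letter (\<lambda>_. 0)) w) = 0"
          unfolding i(3) system_words_map by (simp add: centralizing_word_def)
      qed
    qed
  qed
  have "(\<lambda>\<alpha>. proj (x \<alpha>)) \<in> {..<r} \<rightarrow> carrier (D Mod N)"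
    using x by (auto simp: carrier_quotient)
  from strongly_verbally_closed_solve[OF svc group_quotient incl_hom incl_inj incl_verbally_closed finW W this solved]
  obtain z where z: "z \<in> {..<r} \<rightarrow> carrier H" "\<forall>w\<in>W. word_value H z w = \<one>" by (rule bexE)
  have zc: "z \<alpha> \<in> carrier H" if "\<alpha> < r" for \<alpha> using z(1) that by auto
  have vr: "\<sigma> * t + i < r" if "i < R" for i using that by (simp add: r_def)
  show thesis
  proof (rule that[of "\<lambda>s j. z (s * t + j)" "\<lambda>i. z (\<sigma> * t + i)"])
    show "a s = list_prod H (\<lambda>j. z (s * t + j)) [0..<t]" if s: "s < \<sigma>" for s
    proof -
      have "product_word (s * t) t (inv (a s)) \<in> W" using s by (auto simp: W_def W1_def)
      then show ?thesis using bspec[OF z(2)] product_word_value[OF a[OF s], of t z "s * t"] zc[OF index'[OF s]] by simp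
    qed
    show "z (s * t + i) \<otimes> z (s' * t + j) = z (s' * t + j) \<otimes> z (s * t + i)"
      if s: "s < \<sigma>" "s' < \<sigma>" "i < t" "j < t" "i \<noteq> j" for s s' i j
    proof -
      have "commutator_word (s * t + i) (s' * t + j) \<in> W2"
        unfolding W2_def using s by (intro image_eqI[of _ _ "(s, s', i, j)"]) simp_all
      then have "commutator_word (s * t + i) (s' * t + j) \<in> W" by (simp add: W_def)
      then show ?thesis
        using bspec[OF z(2)] commutator_word_value[where x = z, OF zc[OF index'[OF s(1,3)]] zc[OF index'[OF s(2,4)]]] by simp
    qed
    show "list_prod H (\<lambda>j. z (0 * t + j)) (?js i) [^] q = z (\<sigma> * t + i) [^] q" if i: "i < R" for i
    proof -
      have js: "set (?js i) \<subseteq> {..<r}" using index0 by auto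
      have "root_word q (\<sigma> * t + i) (?js i) \<in> W" using i by (auto simp: W_def W3_def)
      from bspec[OF z(2) this] have "inv (z (\<sigma> * t + i) [^] q) \<otimes> list_prod H z (?js i) [^] q = \<one>"
        by (simp only: root_word_value[OF vr[OF i] js z(1), of q])
      moreover have "list_prod H z (?js i) \<in> carrier H" using index0 zc by (intro list_prod_closed) auto
      ultimately have "z (\<sigma> * t + i) [^] q = list_prod H z (?js i) [^] q"
        by (subst (asm) inv_mult_eq_one_iff) (simp_all add: zc[OF vr[OF i]])
      then show ?thesis by simp
    qed
    show "z (\<sigma> * t + i) \<otimes> a s = a s \<otimes> z (\<sigma> * t + i)" if i: "i < R" "s < \<sigma>" for i s
    proof -
      have "centralizing_word (\<sigma> * t + i) (a s) (inv (a s)) \<in> W" using i by (auto simp: W_def W4_def)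
      then show ?thesis using bspec[OF z(2)] centralizing_word_value[where x = z, OF zc[OF vr[OF i(1)]] a[OF i(2)]] by simp
    qed
    show "z (s * t + j) \<in> carrier H" if "s < \<sigma>" "j < t" for s j using zc[OF index'[OF that]] .
    show "z (\<sigma> * t + i) \<in> carrier H" if "i < R" for i using zc[OF vr[OF that]] .
  qed
qed

end

section \<open>Generators modulo the centre, and the theorem\<close>

lemma (in group) finite_generators_modulo_center:
  assumes "finitely_generated_group (G Mod center G)"
  obtains A where "finite A" "A \<subseteq> carrier G" "generate G (center G \<union> A) = carrier G"
proof -
  have "x \<otimes> z \<otimes> inv x = z" if "x \<in> carrier G" "z \<in> center G" for x z
  proof -
    have z: "z \<in> carrier G" "x \<otimes> z = z \<otimes> x" using that by (auto simp: center_def)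
    show ?thesis unfolding z(2) using z(1) that(1) by (simp add: m_assoc)
  qed
  then have normal: "center G \<lhd> G"
    unfolding normal_inv_iff using subgroup_center by simp
  define \<pi> where "\<pi> g = center G #> g" for g
  interpret \<pi>: group_hom G "G Mod center G" \<pi>
    using group_axioms normal.factorgroup_is_group[OF normal] normal.r_coset_hom_Mod[OF normal]
    by (simp add: group_hom_def group_hom_axioms_def \<pi>_def[abs_def])
  have carrier: "carrier (G Mod center G) = \<pi> ` carrier G"
    by (simp add: carrier_FactGroup \<pi>_def[abs_def])
  obtain S where S: "finite S" "S \<subseteq> \<pi> ` carrier G" "generate (G Mod center G) S = \<pi> ` carrier G"
    using assms unfolding finitely_generated_group_def carrier by auto
  obtain A where A: "A \<subseteq> carrier G" "finite A" "S = \<pi> ` A"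
    using finite_subset_image[OF S(1,2)] by auto
  have sub: "center G \<union> A \<subseteq> carrier G" using A(1) subgroup.subset[OF subgroup_center] by simp
  have "g \<in> generate G (center G \<union> A)" if g: "g \<in> carrier G" for g
  proof -
    \<comment> \<open>The image of \<open>g\<close> is that of some \<open>h\<close> in the subgroup
      generated by the lifts \<open>A\<close>; then \<open>g\<close> and \<open>h\<close> differ by
      a central factor.\<close>
    have "\<pi> g \<in> \<pi> ` generate G A"
      using S(3) g \<pi>.generate_img[OF A(1)] by (simp add: A(3))
    then obtain h where h: "h \<in> generate G A" "\<pi> g = \<pi> h" by auto
    have "g \<in> center G #> h"
      using rcos_self[OF g subgroup_center] h(2) by (simp add: \<pi>_def)
    then obtain z where z: "z \<in> center G" "g = z \<otimes> h" by (auto simp: r_coset_def)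
    have "h \<in> generate G (center G \<union> A)" using h(1) mono_generate[of A "center G \<union> A"] by auto
    moreover have "z \<in> generate G (center G \<union> A)" using z(1) by (simp add: generate.incl)
    ultimately show ?thesis unfolding z(2) by (simp add: generate.eng)
  qed
  then have "generate G (center G \<union> A) = carrier G"
    using generate_incl[OF sub] by (intro antisym subsetI) auto
  then show thesis by (rule that[OF A(2,1)])
qed

theorem mainTheorem2:
  fixes H :: "('a, 'm) monoid_scheme" and p k :: nat and b :: 'a
  assumes "strongly_verbally_closed H"
    and "finitely_generated_group (H Mod center H)"
    and "Factorial_Ring.prime p" and "k \<ge> 1"
    and "b \<in> carrier H"
    and "b [^]\<^bsub>H\<^esub> (p ^ k) \<in> center H"
    and "\<not> (\<exists>z \<in> center H. z [^]\<^bsub>H\<^esub> (p ^ k) = b [^]\<^bsub>H\<^esub> (p ^ k))"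
  defines "T \<equiv> {h \<in> carrier H. h [^]\<^bsub>H\<^esub> (p ^ k) = \<one>\<^bsub>H\<^esub> \<and> group_commutator H h b = \<one>\<^bsub>H\<^esub>}"
  shows "(\<forall>n\<ge>1. \<exists>K :: nat \<Rightarrow> 'a set.
            (\<forall>i\<in>{1..n}. subgroup (K i) H) \<and>
            (\<forall>i\<in>{1..n}. \<forall>j\<in>{1..n}. i \<noteq> j \<longrightarrow>
               (\<forall>x\<in>K i. \<forall>y\<in>K j. x \<otimes>\<^bsub>H\<^esub> y = y \<otimes>\<^bsub>H\<^esub> x)) \<and>
            carrier H = foldr (\<lambda>i A. K i <#>\<^bsub>H\<^esub> A) [1..<Suc n] {\<one>\<^bsub>H\<^esub>} \<and>
            (\<forall>i\<in>{1..n}. \<not> K i \<subseteq> centralizer H T))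
         \<and> \<not> T \<subseteq> center H"
proof -
  interpret group H using assms(1) by (simp add: strongly_verbally_closed_def)
  define q where "q = p ^ k"
  have q: "q > 0" using assms(3) by (simp add: q_def prime_gt_0_nat)
  obtain A where A: "finite A" "A \<subseteq> carrier H" "generate H (center H \<union> A) = carrier H"
    using finite_generators_modulo_center[OF assms(2)] .
  obtain as where as: "set as = A" using A(1) finite_list by auto
  define \<sigma> where "\<sigma> = Suc (length as)"
  \<comment> \<open>\<open>b\<close> gets index 0, the row to which the root equations refer; the
    other entries list the generators modulo the centre.\<close>
  define a where "a s = (b # as) ! s" for s
  have a0: "a 0 = b" and \<sigma>: "0 < \<sigma>" by (simp_all add: a_def \<sigma>_def)
  have a_img: "a ` {..<\<sigma>} = insert b A"
    using nth_image[of \<sigma> "b # as"] by (simp add: a_def[abs_def] \<sigma>_def as atLeast0LessThan)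
  have a: "a s \<in> carrier H" if "s < \<sigma>" for s
  proof -
    have "a s \<in> insert b A" using a_img that by blast
    then show ?thesis using A(2) assms(5) by blast
  qed
  have a_sub: "center H \<union> a ` {..<\<sigma>} \<subseteq> carrier H"
    using a subgroup.subset[OF subgroup_center] by auto
  have gen: "generate H (center H \<union> a ` {..<\<sigma>}) = carrier H"
  proof (rule antisym[OF generate_incl[OF a_sub]])
    have "center H \<union> A \<subseteq> center H \<union> a ` {..<\<sigma>}" unfolding a_img by (rule Un_mono) (rule subset_refl, rule subset_insertI)
    from mono_generate[OF this] show "carrier H \<subseteq> generate H (center H \<union> a ` {..<\<sigma>})" by (simp only: A(3))
  qed
  have bq: "b [^]\<^bsub>H\<^esub> q \<in> center H" using assms(6) by (simp add: q_def)
  have bq_a: "b [^]\<^bsub>H\<^esub> q = a 0 [^]\<^bsub>H\<^esub> q" by (simp add: a0)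
  have nroot: "\<not> (\<exists>z\<in>center H. z [^]\<^bsub>H\<^esub> q = a 0 [^]\<^bsub>H\<^esub> q)" using assms(7) by (simp add: q_def a0)
  have T: "T = {h \<in> carrier H. h [^]\<^bsub>H\<^esub> q = \<one>\<^bsub>H\<^esub> \<and> group_commutator H h (a 0) = \<one>\<^bsub>H\<^esub>}"
    by (simp add: T_def q_def a0)
  have main: "\<exists>K :: nat \<Rightarrow> 'a set. (\<forall>i\<in>{1..n}. subgroup (K i) H) \<and>
      (\<forall>i\<in>{1..n}. \<forall>j\<in>{1..n}. i \<noteq> j \<longrightarrow> (\<forall>x\<in>K i. \<forall>y\<in>K j. x \<otimes>\<^bsub>H\<^esub> y = y \<otimes>\<^bsub>H\<^esub> x)) \<and>
      carrier H = foldr (\<lambda>i A. K i <#>\<^bsub>H\<^esub> A) [1..<Suc n] {\<one>\<^bsub>H\<^esub>} \<and>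
      (\<forall>i\<in>{1..n}. \<not> K i \<subseteq> centralizer H T)" if n: "n \<ge> 1" for n
  proof -
    \<comment> \<open>The incidences, and with them \<open>t\<close> and \<open>R\<close>, are
      chosen for the given \<open>n\<close>, so the enlarged group varies with
      \<open>n\<close>.\<close>
    obtain t R :: nat and e :: "nat \<Rightarrow> nat \<Rightarrow> bool" where cover: "\<And>s :: nat \<Rightarrow> int. \<exists>y<t. int q dvd (\<Sum>i<R. s i * of_bool (e i y))"
      and e: "\<And>J. \<lbrakk>J \<subseteq> {..<t}; card J \<le> n\<rbrakk> \<Longrightarrow> \<exists>i<R. \<forall>y\<in>J. e i y"
      by (rule covering_family[OF q, where n = n]) (rule that)
    interpret root_adjunction H "b [^]\<^bsub>H\<^esub> q" q t R e
      by unfold_locales (fact bq q cover)+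
    obtain x v where x: "\<And>s j. \<lbrakk>s < \<sigma>; j < t\<rbrakk> \<Longrightarrow> x s j \<in> carrier H"
      and v: "\<And>i. i < R \<Longrightarrow> v i \<in> carrier H"
      and prod: "\<And>s. s < \<sigma> \<Longrightarrow> a s = list_prod H (x s) [0..<t]"
      and comm: "\<And>s s' i j. \<lbrakk>s < \<sigma>; s' < \<sigma>; i < t; j < t; i \<noteq> j\<rbrakk> \<Longrightarrow>
        x s i \<otimes>\<^bsub>H\<^esub> x s' j = x s' j \<otimes>\<^bsub>H\<^esub> x s i"
      and root: "\<And>i. i < R \<Longrightarrow> list_prod H (x 0) (filter (e i) [0..<t]) [^]\<^bsub>H\<^esub> q = v i [^]\<^bsub>H\<^esub> q"
      and v_comm: "\<And>i s. \<lbrakk>i < R; s < \<sigma>\<rbrakk> \<Longrightarrow> v i \<otimes>\<^bsub>H\<^esub> a s = a s \<otimes>\<^bsub>H\<^esub> v i"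
      by (rule commuting_coordinates_system[where a = a, OF assms(1) \<sigma> a bq_a]) (assumption, rule that)
    have v_center: "v i \<in> center H" if "i < R" for i
      using v v_comm that a_sub by (intro in_centerI[OF gen]) auto
    obtain J where J: "J \<subseteq> {..<t}" "card J = n" "\<And>j. j \<in> J \<Longrightarrow> \<exists>s<\<sigma>. x s j \<notin> centralizer H T"
      using many_noncentral_coordinates[OF a x gen prod comm \<sigma> v_center root e n nroot] unfolding T by auto
    show ?thesis
      by (rule decomposition_of_commuting_coordinates[OF a x gen prod comm J(1,2) n J(3)])
  qed
  moreover have "\<not> T \<subseteq> center H"
  proof
    \<comment> \<open>The case \<open>n = 1\<close> suffices: the centraliser of a central set is
      all of \<open>H\<close> and would contain \<open>K 1\<close>.\<close>
    assume "T \<subseteq> center H"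
    then have "centralizer H T = carrier H" by (auto simp: centralizer_def center_def)
    moreover obtain K :: "nat \<Rightarrow> 'a set" where "subgroup (K 1) H" "\<not> K 1 \<subseteq> centralizer H T"
      using main[of 1] by auto
    ultimately show False using subgroup.subset[of "K 1" H] by simp
  qed
  ultimately show ?thesis by simp
qed

end
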